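(* Let $G=(V,E)$ be any finite bipartite graph, and for every vertex $u\in V$ fix an arbitrary strict total order (its preference order) over $V\setminus\{u\}$. Run the Random Decision Order (RDO) algorithm on $G$ with these preference orders. Then $\mathbb{E}[|M|]\ge 0.639\cdot|M^*|$, where $M$ is the (random) matching output by RDO and $M^*$ is a maximum matching of $G$.
   Context: Random Decision Order (RDO): every vertex $u$ independently draws a rank (decision time) $y_u$ uniformly from $[0,1]$. Vertices are processed in ascending order of their ranks, starting from the empty matching. When vertex $u$ is processed, if $u$ is still unmatched and has at least one unmatched neighbor in $G$, then $u$ is matched to the unmatched neighbor that comes first in $u$'s preference order; otherwise nothing happens. The preference orders are fixed in advance and do not depend on the ranks. (The algorithm is oblivious: it does not know $E$ in advance and learns whether a pair is an edge only by probing it; a probed existing edge whose endpoints are both unmatched is irrevocably added.) *)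

theory Defs
  imports "HOL-Probability.Probability"
begin

definition simple_graph :: "'v set \<Rightarrow> 'v set set \<Rightarrow> bool" where
  "simple_graph V E \<longleftrightarrow> finite V \<and> (\<forall>e\<in>E. \<exists>u v. u \<in> V \<and> v \<in> V \<and> u \<noteq> v \<and> e = {u, v})"

definition bipartite :: "'v set \<Rightarrow> 'v set set \<Rightarrow> bool" where
  "bipartite V E \<longleftrightarrow>
     (\<exists>A B. A \<union> B = V \<and> A \<inter> B = {} \<and> (\<forall>e\<in>E. \<exists>a b. a \<in> A \<and> b \<in> B \<and> e = {a, b}))"

definition matching :: "'v set set \<Rightarrow> 'v set set \<Rightarrow> bool" where
  "matching E M \<longleftrightarrow> M \<subseteq> E \<and> disjoint M"

definition maximum_matching :: "'v set set \<Rightarrow> 'v set set \<Rightarrow> bool" where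
  "maximum_matching E M \<longleftrightarrow> matching E M \<and> (\<forall>M'. matching E M' \<longrightarrow> card M' \<le> card M)"

text \<open>
  A pair \<open>(v, w) \<in> pref u\<close> means that \<open>u\<close> prefers \<open>v\<close> to \<open>w\<close>, i.e. \<open>v\<close> comes first.
\<close>

definition preference_orders :: "'v set \<Rightarrow> ('v \<Rightarrow> ('v \<times> 'v) set) \<Rightarrow> bool" where
  "preference_orders V pref \<longleftrightarrow>
     (\<forall>u\<in>V. pref u \<subseteq> (V - {u}) \<times> (V - {u}) \<and> strict_linear_order_on (V - {u}) (pref u))"

definition unmatched_neighbors :: "'v set set \<Rightarrow> 'v set set \<Rightarrow> 'v \<Rightarrow> 'v set" where
  "unmatched_neighbors E M u = {v. {u, v} \<in> E \<and> v \<notin> \<Union>M}"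

definition first_in :: "('v \<times> 'v) set \<Rightarrow> 'v set \<Rightarrow> 'v" where
  "first_in r S = (THE v. v \<in> S \<and> (\<forall>w\<in>S - {v}. (v, w) \<in> r))"

definition rdo_step ::
  "'v set set \<Rightarrow> ('v \<Rightarrow> ('v \<times> 'v) set) \<Rightarrow> 'v \<Rightarrow> 'v set set \<Rightarrow> 'v set set" where
  "rdo_step E pref u M =
     (if u \<notin> \<Union>M \<and> unmatched_neighbors E M u \<noteq> {}
      then insert {u, first_in (pref u) (unmatched_neighbors E M u)} M
      else M)"

text \<open>
  Equal ranks, an event of probability zero, are broken by a fixed enumeration of \<open>V\<close>
  that does not depend on the ranks (\<^const>\<open>sort_key\<close> is stable).
\<close>

definition decision_order :: "'v set \<Rightarrow> ('v \<Rightarrow> real) \<Rightarrow> 'v list" where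
  "decision_order V y = sort_key y (SOME us. distinct us \<and> set us = V)"

definition rdo ::
  "'v set \<Rightarrow> 'v set set \<Rightarrow> ('v \<Rightarrow> ('v \<times> 'v) set) \<Rightarrow> ('v \<Rightarrow> real) \<Rightarrow> 'v set set" where
  "rdo V E pref y = fold (rdo_step E pref) (decision_order V y) {}"

definition rank_measure :: "'v set \<Rightarrow> ('v \<Rightarrow> real) measure" where
  "rank_measure V = (\<Pi>\<^sub>M u\<in>V. uniform_measure lborel {0..1})"

end

(*
  Every matched edge carries a unit of gain: if a vertex decides at time t and picks a neighbour,
  it keeps h(t) and hands over 1 - h(t), for a non-decreasing h with values in [0, 1/2]. So it
  suffices that the two endpoints u, v of an edge of the maximum matching receive 0.639 in
  expectation, and for this the ranks of all other vertices may be fixed.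

  Delete u and let v never decide. Then there is a threshold time up to which v is unmatched and
  still has an unmatched neighbour; at the threshold, either v gets picked or its last neighbour is
  gone. By bipartiteness, reinserting u can only help v. Hence v has gain at least h(y_v) if it
  decides before its threshold b, and at least 1 - h(b) if it decides after being picked at time b.
  The same holds for u with threshold a. If u decides before v, after its own threshold and without
  having been picked, while v is still available, then v is its only neighbour left, u picks it, and
  the two share a full unit. Say a <= b. Integrating these bounds over (y_u, y_v) in the unit square
  gives a function of a and b that depends on whether u or v is picked. It remains to exhibit an h
  for which it is at least 0.639 in all cases.
*)

theory Submission
  imports Defs
begin

subsection \<open>Deterministic analysis of the matching process\<close>

lemma first_in_unique_least:
  assumes r: "strict_linear_order_on X r" and S: "finite S" "S \<noteq> {}" "S \<subseteq> X"
  shows "\<exists>!v. v \<in> S \<and> (\<forall>w\<in>S - {v}. (v, w) \<in> r)"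
proof -
  from r have tr: "trans r" and irr: "irrefl r" and tot: "total_on X r"
    by (auto simp: strict_linear_order_on_def)
  have "\<exists>v. v \<in> S \<and> (\<forall>w\<in>S - {v}. (v, w) \<in> r)"
    using S
  proof (induction S rule: finite_ne_induct)
    case (singleton x)
    then show ?case by auto
  next
    case (insert x F)
    then obtain v where v: "v \<in> F" "\<forall>w\<in>F - {v}. (v, w) \<in> r" by auto
    with insert have "v \<noteq> x" by auto
    then consider "(v, x) \<in> r" | "(x, v) \<in> r"
      using tot v insert unfolding total_on_def by blast
    then show ?case
    proof cases
      case 1
      with v show ?thesis by auto
    next
      case 2
      with v tr have "\<forall>w\<in>F. (x, w) \<in> r" by (metis DiffI singletonD transE)
      then show ?thesis by auto
    qed
  qed
  moreover have "v = v'"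
    if "v \<in> S" "\<forall>w\<in>S - {v}. (v, w) \<in> r" "v' \<in> S" "\<forall>w\<in>S - {v'}. (v', w) \<in> r" for v v'
  proof (rule ccontr)
    assume "v \<noteq> v'"
    with that have "(v, v') \<in> r" "(v', v) \<in> r" by auto
    with tr irr show False by (meson irrefl_def transE)
  qed
  ultimately show ?thesis by blast
qed

lemma first_in_mem:
  assumes "strict_linear_order_on X r" "finite S" "S \<noteq> {}" "S \<subseteq> X"
  shows "first_in r S \<in> S"
  using theI'[OF first_in_unique_least[OF assms]] unfolding first_in_def by blast

lemma first_in_subset:
  assumes r: "strict_linear_order_on X r" and S: "finite S" "S \<subseteq> X"
    and T: "T \<subseteq> S" "first_in r S \<in> T"
  shows "first_in r T = first_in r S"
proof -
  have ne: "S \<noteq> {}" "T \<noteq> {}" "finite T" "T \<subseteq> X" using assms by (auto intro: finite_subset)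
  have "\<forall>w\<in>S - {first_in r S}. (first_in r S, w) \<in> r"
    using theI'[OF first_in_unique_least[OF r S(1) ne(1) S(2)]] unfolding first_in_def by blast
  then have "first_in r S \<in> T \<and> (\<forall>w\<in>T - {first_in r S}. (first_in r S, w) \<in> r)"
    using T by auto
  then show ?thesis
    unfolding first_in_def[of r T]
    by (intro the1_equality first_in_unique_least[OF r ne(3) ne(2) ne(4)]) auto
qed

section \<open>Matching steps on sets of unmatched vertices and on oriented pairs\<close>

definition nbrs :: "'v set set \<Rightarrow> 'v set \<Rightarrow> 'v \<Rightarrow> 'v set" where
  "nbrs E S u = {v \<in> S. {u, v} \<in> E}"

text \<open>Only the set of unmatched vertices is tracked, so deleting a vertex in advance means
  running the same process from a smaller set.\<close>

definition avail_step ::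
  "'v set set \<Rightarrow> ('v \<Rightarrow> ('v \<times> 'v) set) \<Rightarrow> 'v \<Rightarrow> 'v set \<Rightarrow> 'v set" where
  "avail_step E pref u S =
     (if u \<in> S \<and> nbrs E S u \<noteq> {} then S - {u, first_in (pref u) (nbrs E S u)} else S)"

text \<open>Unlike the edges of \<open>rdo_step\<close>, these pairs record who decided and who was
  picked, which the division of the gain needs.\<close>

definition probe_step ::
  "'v set \<Rightarrow> 'v set set \<Rightarrow> ('v \<Rightarrow> ('v \<times> 'v) set) \<Rightarrow> 'v \<Rightarrow> ('v \<times> 'v) set \<Rightarrow> ('v \<times> 'v) set" where
  "probe_step V E pref u D =
     (if u \<in> V - Field D \<and> nbrs E (V - Field D) u \<noteq> {}
      then insert (u, first_in (pref u) (nbrs E (V - Field D) u)) D else D)"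

lemma avail_step_subset: "avail_step E pref u S \<subseteq> S"
  by (auto simp: avail_step_def)

lemma avail_subset: "fold (avail_step E pref) us S \<subseteq> S"
proof (induction us arbitrary: S)
  case (Cons u us)
  then show ?case using avail_step_subset[of E pref u S] by (simp) (blast)
qed simp

lemma avail_append_subset:
  "fold (avail_step E pref) (us @ vs) S \<subseteq> fold (avail_step E pref) us S"
  by (simp add: avail_subset)

text \<open>A vertex outside the current set never acts and never returns, so its turns may be
  dropped.\<close>

lemma avail_filter:
  assumes "R \<inter> S = {}"
  shows "fold (avail_step E pref) (filter (\<lambda>x. x \<notin> R) us) S = fold (avail_step E pref) us S"
  using assms
proof (induction us arbitrary: S)
  case (Cons u us)
  have "u \<in> R \<Longrightarrow> avail_step E pref u S = S" using Cons.prems by (auto simp: avail_step_def)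
  moreover have "R \<inter> avail_step E pref u S = {}"
    using Cons.prems avail_step_subset[of E pref u S] by blast
  ultimately show ?case using Cons by auto
qed simp

lemma fold_mono_subset:
  assumes "\<And>u D. D \<subseteq> f u D"
  shows "D \<subseteq> fold f us D"
proof (induction us arbitrary: D)
  case (Cons u us)
  then show ?case using assms[of D u] by simp blast
qed simp

lemma probe_mono: "D \<subseteq> fold (probe_step V E pref) us D"
  by (rule fold_mono_subset) (auto simp: probe_step_def)

section \<open>Monotonicity in bipartite graphs under vertex removal\<close>

locale bipartite_rdo =
  fixes V :: "'v set" and E :: "'v set set" and pref :: "'v \<Rightarrow> ('v \<times> 'v) set"
    and A B :: "'v set"
  assumes fin: "finite V"
    and parts: "A \<union> B = V" "A \<inter> B = {}"
    and edge_parts: "e \<in> E \<Longrightarrow> \<exists>a b. a \<in> A \<and> b \<in> B \<and> e = {a, b}"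
    and prefs: "preference_orders V pref"
begin

abbreviation avail :: "'v set \<Rightarrow> 'v list \<Rightarrow> 'v set" where
  "avail S us \<equiv> fold (avail_step E pref) us S"

abbreviation pairs :: "'v list \<Rightarrow> ('v \<times> 'v) set" where
  "pairs us \<equiv> fold (probe_step V E pref) us {}"

lemma swapped: "bipartite_rdo V E pref B A"
proof unfold_locales
  show "\<exists>a b. a \<in> B \<and> b \<in> A \<and> e = {a, b}" if "e \<in> E" for e
    using edge_parts[OF that] by (metis insert_commute)
qed (use fin parts prefs in auto)

lemma edgeD: "{u, v} \<in> E \<Longrightarrow> u \<in> A \<and> v \<in> B \<or> u \<in> B \<and> v \<in> A"
  using edge_parts[of "{u, v}"] by (auto simp: doubleton_eq_iff)

lemma edge_in_V: "{u, v} \<in> E \<Longrightarrow> u \<in> V \<and> v \<in> V \<and> u \<noteq> v"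
  using edgeD[of u v] parts by blast

lemma nbrs_subset: "nbrs E S u \<subseteq> V - {u}"
  using edge_in_V by (auto simp: nbrs_def)

lemma nbrs_finite: "finite (nbrs E S u)"
  using fin nbrs_subset finite_subset by (metis finite_Diff)

lemma order_on: "nbrs E S u \<noteq> {} \<Longrightarrow> strict_linear_order_on (V - {u}) (pref u)"
  using prefs edge_in_V by (auto simp: preference_orders_def nbrs_def)

lemma first_in_nbrs: "nbrs E S u \<noteq> {} \<Longrightarrow> first_in (pref u) (nbrs E S u) \<in> nbrs E S u"
  using first_in_mem[OF order_on nbrs_finite _ nbrs_subset] by blast

lemma first_in_nbrs_subset:
  assumes "nbrs E T u \<subseteq> nbrs E S u" "first_in (pref u) (nbrs E S u) \<in> nbrs E T u"
  shows "first_in (pref u) (nbrs E T u) = first_in (pref u) (nbrs E S u)"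
  using assms first_in_subset[OF order_on nbrs_finite nbrs_subset] by blast

text \<open>The options of \<open>u\<close> lie in \<open>B\<close>, where \<open>S'\<close> is
  richer, while \<open>u\<close> in \<open>S'\<close> implies \<open>u\<close> in \<open>S\<close>.
  If the choice of \<open>u\<close> in \<open>S'\<close> is present in \<open>S\<close>, it is the
  first choice there too and leaves both sets. If \<open>u\<close> finds a partner in
  \<open>S\<close>, it also finds one in \<open>S'\<close>, unless it is gone from there
  already.\<close>

lemma avail_step_mono_aux:
  assumes B: "S \<inter> B \<subseteq> S'" and A: "S' \<inter> A \<subseteq> S" and u: "u \<in> A"
  shows "avail_step E pref u S \<inter> B \<subseteq> avail_step E pref u S'"
    and "avail_step E pref u S' \<inter> A \<subseteq> avail_step E pref u S"
proof -
  have nB: "nbrs E T u \<subseteq> B" for T using edgeD u parts by (auto simp: nbrs_def)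
  have sub: "nbrs E S u \<subseteq> nbrs E S' u" using nB B by (auto simp: nbrs_def)
  let ?f = "\<lambda>T. first_in (pref u) (nbrs E T u)"
  have f: "nbrs E T u \<noteq> {} \<Longrightarrow> ?f T \<in> nbrs E T u" for T by (rule first_in_nbrs)
  have eq: "?f S = ?f S'" if "?f S' \<in> S" "nbrs E S' u \<noteq> {}"
    using first_in_nbrs_subset[OF sub] f[OF that(2)] that(1) by (auto simp: nbrs_def)
  have uB: "u \<notin> B" using u parts by auto
  have fA: "nbrs E T u \<noteq> {} \<Longrightarrow> ?f T \<notin> A" for T using f[of T] nB[of T] parts by blast
  show "avail_step E pref u S \<inter> B \<subseteq> avail_step E pref u S'"
  proof
    fix x assume x: "x \<in> avail_step E pref u S \<inter> B"
    then have xS: "x \<in> S" "x \<in> B" "x \<in> S'" "x \<noteq> u" using avail_step_subset[of E pref u S] B uB by auto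
    show "x \<in> avail_step E pref u S'"
    proof (rule ccontr)
      assume "x \<notin> avail_step E pref u S'"
      with xS have c: "u \<in> S'" "nbrs E S' u \<noteq> {}" "x = ?f S'"
        by (auto simp: avail_step_def split: if_splits)
      then have "u \<in> S" "x = ?f S" "x \<in> nbrs E S u"
        using A u eq xS f[OF c(2)] by (auto simp: nbrs_def)
      with x show False by (auto simp: avail_step_def split: if_splits)
    qed
  qed
  show "avail_step E pref u S' \<inter> A \<subseteq> avail_step E pref u S"
  proof
    fix x assume x: "x \<in> avail_step E pref u S' \<inter> A"
    then have xS: "x \<in> S'" "x \<in> A" "x \<in> S" using avail_step_subset[of E pref u S'] A by auto
    show "x \<in> avail_step E pref u S"
    proof (rule ccontr)
      assume "x \<notin> avail_step E pref u S"
      with xS have c: "u \<in> S" "nbrs E S u \<noteq> {}" "x = u \<or> x = ?f S"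
        by (auto simp: avail_step_def split: if_splits)
      with fA xS have "x = u" by blast
      with x xS c sub show False by (auto simp: avail_step_def split: if_splits)
    qed
  qed
qed

lemma avail_step_mono:
  assumes "S \<inter> B \<subseteq> S'" "S' \<inter> A \<subseteq> S"
  shows "avail_step E pref u S \<inter> B \<subseteq> avail_step E pref u S' \<and>
    avail_step E pref u S' \<inter> A \<subseteq> avail_step E pref u S"
proof -
  interpret sw: bipartite_rdo V E pref B A by (rule swapped)
  consider "u \<in> A" | "u \<in> B" | "u \<notin> V" using parts by auto
  then show ?thesis
  proof cases
    case 1
    then show ?thesis using avail_step_mono_aux[OF assms] by blast
  next
    case 2
    then show ?thesis using sw.avail_step_mono_aux[OF assms(2,1)] by blast
  next
    case 3
    then have "nbrs E T u = {}" for T using edge_in_V by (auto simp: nbrs_def)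
    then show ?thesis using assms by (auto simp: avail_step_def)
  qed
qed

lemma avail_mono:
  assumes "S \<inter> B \<subseteq> S'" "S' \<inter> A \<subseteq> S"
  shows "avail S us \<inter> B \<subseteq> avail S' us \<and> avail S' us \<inter> A \<subseteq> avail S us"
  using assms
proof (induction us arbitrary: S S')
  case (Cons u us)
  then show ?case using avail_step_mono[of S S' u] by simp
qed simp

text \<open>Compared with \<open>V - {r}\<close>, the start \<open>V\<close> is richer on the side
  of \<open>r\<close>, so by \<open>avail_mono\<close> it never becomes richer on the opposite side,
  where \<open>x\<close> lies.\<close>

lemma avail_remove_opposite:
  assumes e: "{x, r} \<in> E" and x: "x \<notin> avail (V - {r}) us"
  shows "x \<notin> avail V us"
proof -
  interpret sw: bipartite_rdo V E pref B A by (rule swapped)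
  from edgeD[OF e] show ?thesis
  proof
    assume "x \<in> A \<and> r \<in> B"
    then show ?thesis using x sw.avail_mono[of V "V - {r}" us] parts by blast
  next
    assume "x \<in> B \<and> r \<in> A"
    then show ?thesis using x avail_mono[of V "V - {r}" us] parts by blast
  qed
qed

text \<open>Since \<open>u\<close> leaves \<open>x\<close> behind, \<open>x\<close> is not its
  choice, and striking an option that is not chosen keeps the first choice.\<close>

lemma avail_step_remove_unpicked:
  assumes ux: "u \<noteq> x" and x: "x \<in> avail_step E pref u T"
  shows "avail_step E pref u (T - {x}) = avail_step E pref u T - {x}"
proof -
  have xT: "x \<in> T" using x avail_step_subset[of E pref u T] by blast
  show ?thesis
  proof (cases "u \<in> T \<and> nbrs E T u \<noteq> {}")
    case True
    then have f: "first_in (pref u) (nbrs E T u) \<in> nbrs E T u" by (intro first_in_nbrs) simp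
    have "first_in (pref u) (nbrs E T u) \<noteq> x" using True x by (auto simp: avail_step_def)
    with f have f': "first_in (pref u) (nbrs E T u) \<in> nbrs E (T - {x}) u" by (auto simp: nbrs_def)
    have "first_in (pref u) (nbrs E (T - {x}) u) = first_in (pref u) (nbrs E T u)"
      by (rule first_in_nbrs_subset[OF _ f']) (auto simp: nbrs_def)
    then show ?thesis using True f' ux by (auto simp: avail_step_def)
  next
    case False
    then show ?thesis by (auto simp: avail_step_def nbrs_def)
  qed
qed

text \<open>
  No vertex is adjacent to both endpoints of an edge, so whoever picks one of them does so even if
  the other one has been removed.
\<close>

lemma avail_remove_both:
  assumes e: "{x, r} \<in> E" and us: "x \<notin> set us" "r \<notin> set us"
    and xr: "x \<in> avail (V - {r}) us" and rx: "r \<in> avail (V - {x}) us"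
  shows "x \<in> avail V us \<and> r \<in> avail V us \<and> avail (V - {r}) us = avail V us - {r} \<and>
    avail (V - {x}) us = avail V us - {x}"
  using us xr rx
proof (induction us rule: rev_induct)
  case Nil
  then show ?case using edge_in_V[OF e] by auto
next
  case (snoc u us)
  let ?T = "avail V us"
  have "x \<in> avail (V - {r}) us" "r \<in> avail (V - {x}) us"
    using snoc.prems(3,4) avail_append_subset[of E pref us "[u]"] by auto
  with snoc have IH: "x \<in> ?T" "r \<in> ?T" "avail (V - {r}) us = ?T - {r}" "avail (V - {x}) us = ?T - {x}"
    by auto
  have p: "x \<in> avail_step E pref u (?T - {r})" "r \<in> avail_step E pref u (?T - {x})"
    using snoc.prems(3,4) IH by auto
  have ux: "u \<noteq> x" "u \<noteq> r" using snoc.prems by auto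
  have not_both: "nbrs E ?T u = nbrs E (?T - {r}) u \<or> nbrs E ?T u = nbrs E (?T - {x}) u"
    using edgeD[OF e] edgeD[of u x] edgeD[of u r] parts by (auto simp: nbrs_def)
  \<comment> \<open>One endpoint is not adjacent to \<open>u\<close>. By \<open>key\<close> its
    removal does not affect what \<open>u\<close> does, so the other endpoint survives in
    \<open>?T\<close>; by \<open>key2\<close> it cannot be picked by \<open>u\<close>
    itself.\<close>
  have key: "z \<in> avail_step E pref u ?T"
    if "z \<in> avail_step E pref u (?T - {w})" "nbrs E ?T u = nbrs E (?T - {w}) u" "u \<noteq> w" for z w
    using that by (auto simp: avail_step_def split: if_splits)
  have key2: "z \<in> avail_step E pref u ?T"
    if "nbrs E ?T u = nbrs E (?T - {z}) u" "z \<in> ?T" "u \<noteq> z" for z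
  proof -
    have "z \<notin> nbrs E ?T u" using that(1) by (auto simp: nbrs_def)
    then show ?thesis using that(2,3) first_in_nbrs[of ?T u] by (auto simp: avail_step_def)
  qed
  have "x \<in> avail_step E pref u ?T \<and> r \<in> avail_step E pref u ?T"
    using not_both key key2 p ux IH(1,2) by blast
  then show ?case
    using avail_step_remove_unpicked[of u x ?T] avail_step_remove_unpicked[of u r ?T] ux IH by auto
qed

section \<open>Oriented pairs versus the edges of the matching\<close>

lemma probe_step_cases:
  assumes "u \<in> V"
  obtains "probe_step V E pref u D = D" "avail_step E pref u (V - Field D) = V - Field D"
  | v where "probe_step V E pref u D = insert (u, v) D" "u \<notin> Field D" "v \<in> V - Field D"
      "{u, v} \<in> E" "avail_step E pref u (V - Field D) = V - Field D - {u, v}"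
proof (cases "u \<in> V - Field D \<and> nbrs E (V - Field D) u \<noteq> {}")
  case True
  then have "first_in (pref u) (nbrs E (V - Field D) u) \<in> nbrs E (V - Field D) u"
    by (intro first_in_nbrs) simp
  with True that(2)[of "first_in (pref u) (nbrs E (V - Field D) u)"] show ?thesis
    by (simp add: probe_step_def avail_step_def nbrs_def)
next
  case False
  then show ?thesis using that(1) by (simp only: probe_step_def avail_step_def if_False)
qed

lemma pairs_props:
  assumes "set us \<subseteq> V"
  shows "V - Field (pairs us) = avail V us \<and> pairs us \<subseteq> set us \<times> V \<and>
    (\<forall>(a, b)\<in>pairs us. {a, b} \<in> E)"
  using assms
proof (induction us rule: rev_induct)
  case (snoc u us)
  obtain D where D: "pairs us = D" by simp
  from snoc D have IH: "avail V us = V - Field D" "D \<subseteq> set us \<times> V" "\<forall>(a, b)\<in>D. {a, b} \<in> E"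
    by auto
  have u: "u \<in> V" using snoc.prems by simp
  show ?case
  proof (cases rule: probe_step_cases[OF u, of D])
    case 1
    then show ?thesis using IH D by auto
  next
    case (2 v)
    then show ?thesis using IH D by (auto simp: Field_insert)
  qed
qed simp

lemma rdo_eq_pairs:
  assumes "set us \<subseteq> V"
  shows "fold (rdo_step E pref) us {} = (\<lambda>(a, b). {a, b}) ` pairs us"
  using assms
proof (induction us rule: rev_induct)
  case (snoc u us)
  obtain D where D: "pairs us = D" by simp
  have U: "\<Union>((\<lambda>(a, b). {a, b}) ` D) = Field D"
    by (auto simp: Field_def Domain_def Range_def)
  have N: "unmatched_neighbors E ((\<lambda>(a, b). {a, b}) ` D) u = nbrs E (V - Field D) u"
    unfolding unmatched_neighbors_def nbrs_def U using edge_in_V by auto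
  have IH: "fold (rdo_step E pref) us {} = (\<lambda>(a, b). {a, b}) ` D" and u: "u \<in> V"
    using snoc D by auto
  have "rdo_step E pref u ((\<lambda>(a, b). {a, b}) ` D) = (\<lambda>(a, b). {a, b}) ` probe_step V E pref u D"
    unfolding rdo_step_def probe_step_def U N using u by simp
  then show ?case by (simp add: IH D)
qed simp

lemma card_rdo_eq_pairs:
  assumes "set us \<subseteq> V"
  shows "finite (pairs us)" "card (fold (rdo_step E pref) us {}) = card (pairs us)"
proof -
  have "pairs us \<subseteq> V \<times> V" using pairs_props[OF assms] assms by blast
  then show "finite (pairs us)" using fin finite_subset by blast
  \<comment> \<open>A decider occurs in no second pair, in either role, so forgetting the
    orientation is injective.\<close>
  have "p = q" if "p \<in> pairs us" "q \<in> pairs us" "fst p \<in> {fst q, snd q}" for p q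
    using assms that
  proof (induction us rule: rev_induct)
    case (snoc u us)
    obtain D where D: "pairs us = D" by simp
    have IH: "p \<in> D \<Longrightarrow> q \<in> D \<Longrightarrow> p = q" using snoc D by auto
    have FD: "fst p' \<in> Field D \<and> snd p' \<in> Field D" if "p' \<in> D" for p'
      using that by (cases p') (auto simp: Field_def)
    have u: "u \<in> V" using snoc.prems by simp
    show ?case
    proof (cases rule: probe_step_cases[OF u, of D])
      case 1
      then show ?thesis using IH D snoc.prems by simp
    next
      case (2 v)
      with snoc.prems D have "p \<in> insert (u, v) D" "q \<in> insert (u, v) D" by simp_all
      then show ?thesis using IH snoc.prems(4) 2 FD[of p] FD[of q] by auto
    qed
  qed simp
  then have "inj_on (\<lambda>(a, b). {a, b}) (pairs us)"
    by (fastforce intro!: inj_onI simp: doubleton_eq_iff)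
  then show "card (fold (rdo_step E pref) us {}) = card (pairs us)"
    using rdo_eq_pairs[OF assms] by (simp add: card_image)
qed

lemma matched_by_prefix:
  assumes "set us \<subseteq> V" "us = pre @ post" "w \<in> V" "w \<notin> avail V pre"
  obtains a b where "(a, b) \<in> pairs us" "a \<in> set pre" "w = a \<or> w = b"
proof -
  have "set pre \<subseteq> V" using assms by auto
  then have "w \<in> Field (pairs pre)" "pairs pre \<subseteq> set pre \<times> V"
    using pairs_props[of pre] assms by auto
  moreover have "pairs pre \<subseteq> pairs us" using assms probe_mono[of "pairs pre" V E pref post] by simp
  ultimately show ?thesis using that by (auto simp: Field_def)
qed

end

section \<open>Sorting by rank\<close>

lemma decision_order_props:
  assumes "finite V"
  shows "set (decision_order V y) = V" "distinct (decision_order V y)"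
    "sorted (map y (decision_order V y))"
proof -
  have "\<exists>us. distinct us \<and> set us = V" using finite_distinct_list[OF assms] by blast
  from someI_ex[OF this] show "set (decision_order V y) = V" "distinct (decision_order V y)"
    "sorted (map y (decision_order V y))"
    by (simp_all add: decision_order_def)
qed

lemma insort_key_cong:
  assumes "\<And>a b. a \<in> set (x # xs) \<Longrightarrow> b \<in> set (x # xs) \<Longrightarrow> f a \<le> f b \<longleftrightarrow> g a \<le> g b"
  shows "insort_key f x xs = insort_key g x xs"
  using assms by (induction xs) auto

lemma sort_key_cong_order:
  assumes "\<And>a b. a \<in> set xs \<Longrightarrow> b \<in> set xs \<Longrightarrow> f a \<le> f b \<longleftrightarrow> g a \<le> g b"
  shows "sort_key f xs = sort_key g xs"
  using assms
proof (induction xs)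
  case (Cons x xs)
  then have IH: "sort_key f xs = sort_key g xs" by simp
  show ?case using insort_key_cong[of x "sort_key g xs" f g] Cons.prems by (simp add: IH)
qed simp

lemma sorted_filter_split:
  assumes "sorted (map f xs)" "\<And>a b. f a \<le> f b \<Longrightarrow> P b \<Longrightarrow> P a"
  shows "xs = filter P xs @ filter (\<lambda>x. \<not> P x) xs"
  using assms
proof (induction xs)
  case (Cons x xs)
  show ?case
  proof (cases "P x")
    case True
    then show ?thesis using Cons by simp
  next
    case False
    then have "\<forall>z\<in>set xs. \<not> P z" using Cons.prems by auto
    then show ?thesis using False by (simp add: filter_id_conv filter_empty_conv)
  qed
qed simp

lemma filter_eq_singleton: "distinct xs \<Longrightarrow> x \<in> set xs \<Longrightarrow> filter (\<lambda>w. w = x) xs = [x]"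
  by (induction xs) (auto simp: filter_empty_conv)

section \<open>Division of the gain and thresholds\<close>

definition gain :: "(real \<Rightarrow> real) \<Rightarrow> ('v \<Rightarrow> real) \<Rightarrow> ('v \<times> 'v) set \<Rightarrow> 'v \<Rightarrow> real" where
  "gain h y D w =
     (\<Sum>(a, b)\<in>D. (if a = w then h (y a) else 0) + (if b = w then 1 - h (y a) else 0))"

lemma sum_gain:
  assumes "finite V" "D \<subseteq> V \<times> V"
  shows "(\<Sum>w\<in>V. gain h y D w) = real (card D)"
proof -
  have "(\<Sum>w\<in>V. gain h y D w) =
    (\<Sum>p\<in>D. \<Sum>w\<in>V. (if fst p = w then h (y (fst p)) else 0) + (if snd p = w then 1 - h (y (fst p)) else 0))"
    unfolding gain_def by (subst sum.swap) (simp add: case_prod_beta)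
  also have "\<dots> = (\<Sum>p\<in>D. 1)"
    using assms by (intro sum.cong) (auto simp: sum.distrib)
  finally show ?thesis by simp
qed

text \<open>
  A lower bound for the total gain of an edge whose endpoints have thresholds \<open>a \<le> b\<close> and ranks
  \<open>p\<close> and \<open>q\<close>. If the endpoint with threshold \<open>b\<close> gets picked at time \<open>b\<close>, then \<open>s = t = 1 - h b\<close>.
  If no endpoint gets picked, then \<open>s = 0\<close> and \<open>t = 1\<close>.
\<close>

definition lower :: "(real \<Rightarrow> real) \<Rightarrow> real \<Rightarrow> real \<Rightarrow> real \<Rightarrow> real \<Rightarrow> real \<Rightarrow> real \<Rightarrow> real" where
  "lower h a b s t p q =
     (if p < a then h p + (if q < b then h q else s)
      else if p < b then (if q < p then h q else 1)
      else if q < b then h q else t)"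

text \<open>The bound 1/2 makes being picked worth at least as much as deciding, whatever the two
  times are.\<close>

locale rdo_gain = bipartite_rdo V E pref A B
  for V :: "'v set" and E pref A B +
  fixes h :: "real \<Rightarrow> real"
  assumes h_nonneg: "0 \<le> h t" and h_half: "h t \<le> 1/2" and h_mono: "s \<le> t \<Longrightarrow> h s \<le> h t"
begin

abbreviation ord :: "('v \<Rightarrow> real) \<Rightarrow> 'v list" where
  "ord y \<equiv> decision_order V y"

abbreviation \<alpha> :: "('v \<Rightarrow> real) \<Rightarrow> 'v \<Rightarrow> real" where
  "\<alpha> y \<equiv> gain h y (pairs (ord y))"

text \<open>
  In the following definitions the vertex \<open>r\<close> is deleted and \<open>x\<close> never decides, so nothing depends
  on the ranks of \<open>x\<close> and \<open>r\<close>.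
\<close>

definition others :: "'v \<Rightarrow> 'v \<Rightarrow> ('v \<Rightarrow> real) \<Rightarrow> 'v list" where
  "others x r y = filter (\<lambda>w. w \<notin> {x, r}) (ord y)"

definition state :: "'v \<Rightarrow> 'v \<Rightarrow> ('v \<Rightarrow> real) \<Rightarrow> real \<Rightarrow> 'v set" where
  "state x r y t = avail (V - {r}) (filter (\<lambda>w. y w < t) (others x r y))"

definition good :: "'v \<Rightarrow> 'v \<Rightarrow> ('v \<Rightarrow> real) \<Rightarrow> real \<Rightarrow> bool" where
  "good x r y t \<longleftrightarrow> x \<in> state x r y t \<and> nbrs E (state x r y t) x \<noteq> {}"

definition thr :: "'v \<Rightarrow> 'v \<Rightarrow> ('v \<Rightarrow> real) \<Rightarrow> real" where
  "thr x r y = Sup (insert 0 {t \<in> {0..1}. good x r y t})"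

definition picked :: "'v \<Rightarrow> 'v \<Rightarrow> ('v \<Rightarrow> real) \<Rightarrow> bool" where
  "picked x r y \<longleftrightarrow> x \<notin> avail (V - {r}) (others x r y)"

lemmas ord_set = decision_order_props(1)[OF fin]
  and ord_distinct = decision_order_props(2)[OF fin]
  and ord_sorted = decision_order_props(3)[OF fin]

lemma others_sorted: "sorted (map y (others x r y))"
  unfolding others_def using ord_sorted by (rule sorted_filter)

lemma others_set: "set (others x r y) = V - {x, r}"
  by (auto simp: others_def ord_set)

text \<open>Filtering commutes with the stable sort, so the ranks of \<open>x\<close> and
  \<open>r\<close> are never compared with anything.\<close>

lemma others_cong:
  assumes "\<And>w. w \<in> V - {x, r} \<Longrightarrow> y w = y' w"
  shows "others x r y = others x r y'"
proof -
  let ?us = "SOME us. distinct us \<and> set us = V"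
  have "set ?us = V"
    using someI_ex[of "\<lambda>us. distinct us \<and> set us = V"] finite_distinct_list[OF fin] by blast
  then show ?thesis unfolding others_def decision_order_def filter_sort
    by (intro sort_key_cong_order) (use assms in auto)
qed

text \<open>Lets the thresholds be treated as constants while the ranks of \<open>x\<close> and
  \<open>r\<close> are integrated out.\<close>

lemma local_cong:
  assumes "\<And>w. w \<in> V - {x, r} \<Longrightarrow> y w = y' w"
  shows "thr x r y = thr x r y'" "picked x r y = picked x r y'"
proof -
  have eq: "others x r y = others x r y'" using assms by (rule others_cong)
  then have "filter (\<lambda>w. y w < t) (others x r y) = filter (\<lambda>w. y' w < t) (others x r y')" for t
    using assms by (intro filter_cong) (auto simp: others_set)
  then show "thr x r y = thr x r y'" by (simp add: thr_def good_def state_def)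
  show "picked x r y = picked x r y'" by (simp add: picked_def eq)
qed

lemma state_antimono:
  assumes "s \<le> t"
  shows "state x r y t \<subseteq> state x r y s"
proof -
  let ?L = "filter (\<lambda>w. y w < t) (others x r y)"
  have "?L = filter (\<lambda>w. y w < s) ?L @ filter (\<lambda>w. \<not> y w < s) ?L"
    by (rule sorted_filter_split[where f = y]) (auto intro: sorted_filter others_sorted)
  moreover have "filter (\<lambda>w. y w < s) ?L = filter (\<lambda>w. y w < s) (others x r y)"
    using assms by (auto intro!: filter_cong)
  ultimately show ?thesis unfolding state_def by (metis avail_append_subset)
qed

text \<open>Both unmatched vertices and their unmatched neighbours only disappear over time. Hence
  the good times in [0, 1] form an initial segment, and \<open>thr\<close> is its right end, or 0 if
  there are none.\<close>

lemma good_antimono: "good x r y t \<Longrightarrow> s \<le> t \<Longrightarrow> good x r y s"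
  using state_antimono[where s = s and t = t and x = x and r = r and y = y] by (auto simp: good_def nbrs_def)

lemma thr_bdd: "bdd_above (insert 0 {t \<in> {0..1}. good x r y t})"
  by (rule bdd_aboveI[of _ 1]) auto

lemma thr_bounds: "0 \<le> thr x r y" "thr x r y \<le> 1"
  unfolding thr_def by (auto intro!: cSup_upper thr_bdd cSup_least)

lemma good_below: "t < thr x r y \<Longrightarrow> 0 \<le> t \<Longrightarrow> good x r y t"
  using less_cSup_iff[OF insert_not_empty thr_bdd[of x r y], of t] good_antimono[of x r y _ t]
  by (auto simp: thr_def)

lemma not_good_above: "thr x r y < t \<Longrightarrow> t \<in> {0..1} \<Longrightarrow> \<not> good x r y t"
  unfolding thr_def using cSup_upper[OF _ thr_bdd[of x r y], of t] by auto

lemma pairs_ord: "finite (pairs (ord y))" "pairs (ord y) \<subseteq> V \<times> V"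
  "(a, b) \<in> pairs (ord y) \<Longrightarrow> a \<noteq> b"
  using card_rdo_eq_pairs(1)[of "ord y"] pairs_props[of "ord y"] edge_in_V[of a b] ord_set by auto

lemma summand_nonneg:
  "0 \<le> (if a = w then h (y a) else 0) + (if b = w then 1 - h (y a) else 0)"
  using h_nonneg[of "y a"] h_half[of "y a"] by auto

lemma gain_nonneg: "0 \<le> gain h y D w"
  unfolding gain_def by (intro sum_nonneg) (auto simp: summand_nonneg split del: if_split)

lemma gain_ge:
  assumes "(a, b) \<in> pairs (ord y)"
  shows "\<alpha> y a \<ge> h (y a)" "\<alpha> y b \<ge> 1 - h (y a)"
proof -
  have *: "\<alpha> y w \<ge> (if a = w then h (y a) else 0) + (if b = w then 1 - h (y a) else 0)" for w
    unfolding gain_def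
    by (rule order_trans[OF _ member_le_sum[OF assms]])
      (auto simp: summand_nonneg pairs_ord split del: if_split)
  have "a \<noteq> b" using pairs_ord(3)[OF assms] .
  then show "\<alpha> y a \<ge> h (y a)" "\<alpha> y b \<ge> 1 - h (y a)" using *[of a] *[of b] by auto
qed

lemma sum_alpha: "(\<Sum>w\<in>V. \<alpha> y w) = real (card (rdo V E pref y))"
  using sum_gain[OF fin pairs_ord(2)] card_rdo_eq_pairs(2)[of "ord y"]
  by (simp add: rdo_def ord_set)

section \<open>Gains of the two endpoints of an edge\<close>

lemma gain_by_prefix:
  assumes "ord y = pre @ post" "w \<in> V" "w \<notin> avail V pre"
  obtains a where "a \<in> set pre" "w = a \<and> \<alpha> y w \<ge> h (y w) \<or> \<alpha> y w \<ge> 1 - h (y a)"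
  using matched_by_prefix[OF _ assms] gain_ge ord_set by (metis order_refl)

lemma ord_split_le: "ord y = filter (\<lambda>w. y w \<le> t) (ord y) @ filter (\<lambda>w. \<not> y w \<le> t) (ord y)"
  by (rule sorted_filter_split[OF ord_sorted]) auto

lemma ord_split_at:
  assumes "x \<in> V" "\<And>w. w \<in> V - {x} \<Longrightarrow> y w \<noteq> y x"
  shows "filter (\<lambda>w. y w \<le> y x) (ord y) = filter (\<lambda>w. y w < y x) (ord y) @ [x]"
proof -
  let ?L = "filter (\<lambda>w. y w \<le> y x) (ord y)"
  have "?L = filter (\<lambda>w. y w < y x) ?L @ filter (\<lambda>w. \<not> y w < y x) ?L"
    by (rule sorted_filter_split[where f = y]) (auto intro: sorted_filter ord_sorted)
  moreover have "filter (\<lambda>w. y w < y x) ?L = filter (\<lambda>w. y w < y x) (ord y)"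
    by (auto intro!: filter_cong)
  moreover have "filter (\<lambda>w. \<not> y w < y x) ?L = [x]"
  proof -
    have eq: "w = x" if "w \<in> V" "y w = y x" for w using assms(2)[of w] that by blast
    have "filter (\<lambda>w. \<not> y w < y x) ?L = filter (\<lambda>w. w = x) (ord y)"
      unfolding filter_filter using eq by (intro filter_cong) (auto simp: ord_set)
    also have "\<dots> = [x]"
      using assms(1) ord_set[of y] ord_distinct[of y] by (intro filter_eq_singleton) auto
    finally show ?thesis .
  qed
  ultimately show ?thesis by simp
qed

text \<open>Removing \<open>r\<close> makes its turn void, so the rank of \<open>r\<close> is irrelevant.\<close>

lemma state_eq_avail:
  assumes "t \<le> y x"
  shows "state x r y t = avail (V - {r}) (filter (\<lambda>w. y w < t) (ord y))"
proof -
  have "filter (\<lambda>w. w \<notin> {r}) (filter (\<lambda>w. y w < t) (ord y)) = filter (\<lambda>w. y w < t) (others x r y)"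
    unfolding others_def filter_filter using assms by (intro filter_cong) auto
  then show ?thesis
    using avail_filter[of "{r}" "V - {r}" E pref "filter (\<lambda>w. y w < t) (ord y)"]
    by (simp add: state_def)
qed

text \<open>With \<open>r\<close> deleted, \<open>x\<close> can match at its own turn, so after that
  turn it is matched; by \<open>avail_remove_opposite\<close> the same holds in the real run. Either
  \<open>x\<close> decided itself, or it was picked and has at least 1/2.\<close>

lemma gain_active:
  assumes e: "{x, r} \<in> E" and y: "0 \<le> y x" "\<And>w. w \<in> V - {x} \<Longrightarrow> y w \<noteq> y x"
    and lt: "y x < thr x r y"
  shows "\<alpha> y x \<ge> h (y x)"
proof -
  have xV: "x \<in> V" using edge_in_V[OF e] by simp
  let ?pre = "filter (\<lambda>w. y w < y x) (ord y)"
  have "good x r y (y x)" using good_below[OF lt] y by simp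
  then have "x \<in> avail (V - {r}) ?pre" "nbrs E (avail (V - {r}) ?pre) x \<noteq> {}"
    by (auto simp: good_def state_eq_avail)
  then have "x \<notin> avail (V - {r}) (?pre @ [x])" by (simp add: avail_step_def)
  then have "x \<notin> avail (V - {r}) (filter (\<lambda>w. y w \<le> y x) (ord y))"
    using ord_split_at[of x y, OF xV y(2)] by simp
  then have "x \<notin> avail V (filter (\<lambda>w. y w \<le> y x) (ord y))" by (rule avail_remove_opposite[OF e])
  from gain_by_prefix[OF ord_split_le xV this]
  obtain a where "y a \<le> y x" "x = a \<and> \<alpha> y x \<ge> h (y x) \<or> \<alpha> y x \<ge> 1 - h (y a)" by auto
  then show ?thesis using h_half[of "y a"] h_half[of "y x"] by auto
qed

text \<open>With \<open>r\<close> deleted, \<open>x\<close> is picked no later than its threshold,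
  so in the real run it is matched by then as well. Its own turn comes later, so it was picked by a
  vertex of rank at most the threshold, and \<open>h\<close> is monotone.\<close>

lemma gain_passive:
  assumes e: "{x, r} \<in> E" and P: "picked x r y" and lt: "thr x r y < y x"
    and y: "\<And>w. w \<in> V - {x, r} \<Longrightarrow> y w \<in> {0..1}"
  shows "\<alpha> y x \<ge> 1 - h (thr x r y)"
proof -
  have xV: "x \<in> V" "x \<noteq> r" using edge_in_V[OF e] by auto
  \<comment> \<open>A single turn makes \<open>x\<close> disappear; the vertex \<open>z\<close>
    acting then is the one that picks it.\<close>
  have "\<exists>pre z post. us = pre @ z # post \<and> x \<in> avail S pre \<and> x \<notin> avail S (pre @ [z])"
    if "x \<in> S" "x \<notin> avail S us" for S us
    using that
  proof (induction us rule: rev_induct)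
    case (snoc z us)
    show ?case
    proof (cases "x \<in> avail S us")
      case True
      with snoc show ?thesis by blast
    next
      case False
      with snoc obtain pre z' post where
        "us = pre @ z' # post" "x \<in> avail S pre" "x \<notin> avail S (pre @ [z'])"
        by blast
      then show ?thesis by (intro exI[of _ pre] exI[of _ z'] exI[of _ "post @ [z]"]) simp
    qed
  qed simp
  from this[of "V - {r}" "others x r y"] P xV obtain pre z post where
    L: "others x r y = pre @ z # post" and pre: "x \<in> avail (V - {r}) pre"
      "x \<notin> avail (V - {r}) (pre @ [z])"
    by (auto simp: picked_def)
  have z: "z \<in> V - {x, r}" using L others_set[of x r y] by auto
  have zx: "z \<in> avail (V - {r}) pre" "{z, x} \<in> E"
  proof -
    let ?S = "avail (V - {r}) pre"
    have "x \<notin> avail_step E pref z ?S" using pre(2) by simp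
    then have *: "z \<in> ?S \<and> nbrs E ?S z \<noteq> {} \<and> (x = z \<or> x = first_in (pref z) (nbrs E ?S z))"
      using pre(1) by (auto simp: avail_step_def split: if_splits)
    then show "z \<in> ?S" "{z, x} \<in> E" using z first_in_nbrs[of ?S z] by (auto simp: nbrs_def)
  qed
  have srt: "sorted (map y (pre @ z # post))" using others_sorted[of y x r] L by simp
  \<comment> \<open>Just before the turn of \<open>z\<close>, both \<open>z\<close> and
    \<open>x\<close> are unmatched, and they are adjacent. Vertices of the same rank as
    \<open>z\<close> may already have acted, so the state at time \<open>y z\<close> is only shown
    to contain the current set.\<close>
  have "good x r y (y z)"
  proof -
    have "filter (\<lambda>w. y w < y z) (pre @ z # post) = filter (\<lambda>w. y w < y z) pre"
      using srt by (force simp: sorted_append filter_empty_conv)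
    moreover have "pre = filter (\<lambda>w. y w < y z) pre @ filter (\<lambda>w. \<not> y w < y z) pre"
      using srt by (intro sorted_filter_split[where f = y]) (auto simp: sorted_append)
    then have "avail (V - {r}) pre \<subseteq> avail (V - {r}) (filter (\<lambda>w. y w < y z) pre)"
      by (metis avail_append_subset)
    ultimately have "avail (V - {r}) pre \<subseteq> state x r y (y z)" by (simp add: state_def L)
    then show ?thesis using pre(1) zx by (auto simp: good_def nbrs_def insert_commute)
  qed
  with y[OF z] have yz: "y z \<le> thr x r y" using not_good_above[of x r y "y z"] by force
  let ?t = "thr x r y"
  let ?le = "filter (\<lambda>w. y w \<le> ?t)"
  have "x \<notin> avail (V - {r}) (?le (ord y))"
  proof -
    have "?le (others x r y) = filter (\<lambda>w. w \<notin> {r}) (?le (ord y))"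
      unfolding others_def filter_filter using lt by (intro filter_cong) auto
    then have "avail (V - {r}) (?le (ord y)) = avail (V - {r}) (?le (others x r y))"
      using avail_filter[of "{r}" "V - {r}" E pref "?le (ord y)"] by simp
    moreover have "?le (others x r y) = (pre @ [z]) @ ?le post"
    proof -
      have "\<forall>w\<in>set pre. y w \<le> y z" using srt by (auto simp: sorted_append)
      then have "?le pre = pre" using yz by (auto simp: filter_id_conv)
      then show ?thesis using yz by (simp add: L)
    qed
    ultimately show ?thesis using pre(2) avail_append_subset[of E pref "pre @ [z]" "?le post"]
      by auto
  qed
  then have "x \<notin> avail V (?le (ord y))" by (rule avail_remove_opposite[OF e])
  from gain_by_prefix[OF ord_split_le xV(1) this]
  obtain a where "y a \<le> ?t" "x = a \<or> \<alpha> y x \<ge> 1 - h (y a)" by auto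
  moreover from this lt have "x \<noteq> a" by auto
  ultimately show ?thesis using h_mono[of "y a" ?t] by auto
qed

text \<open>By \<open>avail_remove_both\<close>, both endpoints are still unmatched when
  \<open>x\<close> decides. As this is past the threshold of \<open>x\<close>, which is unmatched,
  no neighbour other than \<open>r\<close> is left, so \<open>x\<close> must pick \<open>r\<close>
  and their shares sum to 1.\<close>

lemma gain_both:
  assumes e: "{x, r} \<in> E" and y: "y x \<in> {0..1}" "\<And>w. w \<in> V - {x} \<Longrightarrow> y w \<noteq> y x"
    and x: "\<not> picked x r y" "thr x r y < y x" and r: "y x < y r" "y x < thr r x y \<or> \<not> picked r x y"
  shows "\<alpha> y x + \<alpha> y r \<ge> 1"
proof -
  have V: "x \<in> V" "r \<in> V" "x \<noteq> r" using edge_in_V[OF e] by auto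
  let ?pre = "filter (\<lambda>w. y w < y x) (ord y)"
  have sx: "state x r y (y x) = avail (V - {r}) ?pre" by (simp add: state_eq_avail)
  have sr: "state r x y (y x) = avail (V - {x}) ?pre" using r by (simp add: state_eq_avail)
  \<comment> \<open>A vertex that survives all turns of the others is present in every earlier
    state.\<close>
  have lazy: "w \<in> state w w' y t" if "\<not> picked w w' y" for w w' t
  proof -
    have "others w w' y = filter (\<lambda>w. y w < t) (others w w' y) @ filter (\<lambda>w. \<not> y w < t) (others w w' y)"
      by (rule sorted_filter_split[OF others_sorted]) auto
    then have "avail (V - {w'}) (others w w' y) \<subseteq> state w w' y t"
      unfolding state_def by (metis avail_append_subset)
    then show ?thesis using that by (auto simp: picked_def)
  qed
  have "r \<in> state r x y (y x)"
    using r(2) lazy good_below[of "y x" r x y] y(1) by (auto simp: good_def)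
  with sx sr lazy[OF x(1)] have
    "x \<in> avail V ?pre \<and> r \<in> avail V ?pre \<and> avail (V - {r}) ?pre = avail V ?pre - {r}"
    using avail_remove_both[OF e, of ?pre] r by auto
  then have av: "x \<in> avail V ?pre" "r \<in> avail V ?pre" "state x r y (y x) = avail V ?pre - {r}"
    using sx by auto
  have "\<not> good x r y (y x)" using not_good_above[OF x(2) y(1)] .
  then have "nbrs E (avail V ?pre - {r}) x = {}"
    using av V by (auto simp: good_def)
  then have N: "nbrs E (avail V ?pre) x = {r}" using av e by (auto simp: nbrs_def)
  have "set ?pre \<subseteq> V" by (auto simp: ord_set)
  then have F: "V - Field (pairs ?pre) = avail V ?pre" using pairs_props by blast
  have f: "first_in (pref x) {r} = r" using first_in_nbrs[of "avail V ?pre" x] N by auto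
  have "(x, r) \<in> pairs (?pre @ [x])"
    unfolding fold_append comp_apply fold.simps id_apply probe_step_def F N f using av by simp
  moreover have "ord y = (?pre @ [x]) @ filter (\<lambda>w. \<not> y w \<le> y x) (ord y)"
    using ord_split_le[of y "y x"] ord_split_at[of x y, OF V(1) y(2)] by simp
  then have "pairs (?pre @ [x]) \<subseteq> pairs (ord y)"
    by (metis fold_append comp_apply probe_mono)
  ultimately have "(x, r) \<in> pairs (ord y)" by blast
  then show ?thesis using gain_ge by fastforce
qed

definition generic :: "'v \<Rightarrow> 'v \<Rightarrow> ('v \<Rightarrow> real) \<Rightarrow> bool" where
  "generic x r y \<longleftrightarrow> y ` V \<subseteq> {0..1} \<and> y x \<notin> y ` (V - {x}) \<and> y r \<notin> y ` (V - {r}) \<and>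
     {y x, y r} \<inter> {thr x r y, thr r x y} = {}"

text \<open>When the endpoint with the smaller threshold gets picked, the active gain of the other
  one is counted only up to that threshold. This is \<open>lower\<close> with both thresholds equal
  and the two ranks interchanged.\<close>

lemma gain_lower_aux:
  assumes e: "{x, r} \<in> E" and le: "thr x r y \<le> thr r x y" and g: "generic x r y"
  shows "picked x r y \<Longrightarrow>
      lower h (thr x r y) (thr x r y) (1 - h (thr x r y)) (1 - h (thr x r y)) (y r) (y x) \<le> \<alpha> y x + \<alpha> y r"
    and "\<not> picked x r y \<Longrightarrow> picked r x y \<Longrightarrow>
      lower h (thr x r y) (thr r x y) (1 - h (thr r x y)) (1 - h (thr r x y)) (y x) (y r) \<le> \<alpha> y x + \<alpha> y r"
    and "\<not> picked x r y \<Longrightarrow> \<not> picked r x y \<Longrightarrow>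
      lower h (thr x r y) (thr r x y) 0 1 (y x) (y r) \<le> \<alpha> y x + \<alpha> y r"
proof -
  have e': "{r, x} \<in> E" using e by (simp add: insert_commute)
  have V: "x \<in> V" "r \<in> V" "x \<noteq> r" using edge_in_V[OF e] by auto
  have y: "y x \<in> {0..1}" "y r \<in> {0..1}" "\<And>w. w \<in> V \<Longrightarrow> y w \<in> {0..1}"
    using g V by (auto simp: generic_def)
  have nx: "y w \<noteq> y x" if "w \<in> V - {x}" for w
    using g imageI[OF that, of y] by (auto simp: generic_def)
  have nr: "y w \<noteq> y r" if "w \<in> V - {r}" for w
    using g imageI[OF that, of y] by (auto simp: generic_def)
  have ne: "y x \<noteq> thr x r y" "y x \<noteq> thr r x y" "y r \<noteq> thr x r y" "y r \<noteq> thr r x y"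
    "y x \<noteq> y r"
    using g nx[of r] V by (auto simp: generic_def)
  have pos: "\<alpha> y x \<ge> 0" "\<alpha> y r \<ge> 0" by (auto simp: gain_nonneg)
  have actx: "y x < thr x r y \<Longrightarrow> \<alpha> y x \<ge> h (y x)" using gain_active[OF e] y nx by auto
  have actr: "y r < thr r x y \<Longrightarrow> \<alpha> y r \<ge> h (y r)" using gain_active[OF e'] y nr by auto
  have pasx: "picked x r y \<Longrightarrow> thr x r y < y x \<Longrightarrow> \<alpha> y x \<ge> 1 - h (thr x r y)"
    using gain_passive[OF e] y by auto
  have pasr: "picked r x y \<Longrightarrow> thr r x y < y r \<Longrightarrow> \<alpha> y r \<ge> 1 - h (thr r x y)"
    using gain_passive[OF e'] y by auto
  have bothx: "\<lbrakk>\<not> picked x r y; thr x r y < y x; y x < y r; y x < thr r x y \<or> \<not> picked r x y\<rbrakk>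
    \<Longrightarrow> \<alpha> y x + \<alpha> y r \<ge> 1"
    using gain_both[OF e, of y] y nx by auto
  have bothr: "\<lbrakk>\<not> picked r x y; thr r x y < y r; y r < y x; y r < thr x r y \<or> \<not> picked x r y\<rbrakk>
    \<Longrightarrow> \<alpha> y x + \<alpha> y r \<ge> 1"
    using gain_both[OF e', of y] y nr by (auto simp: add.commute)
  show "lower h (thr x r y) (thr x r y) (1 - h (thr x r y)) (1 - h (thr x r y)) (y r) (y x) \<le> \<alpha> y x + \<alpha> y r"
    if "picked x r y"
    using that le ne pos actx actr pasx unfolding lower_def by (smt (verit))
  show "lower h (thr x r y) (thr r x y) (1 - h (thr r x y)) (1 - h (thr r x y)) (y x) (y r) \<le> \<alpha> y x + \<alpha> y r"
    if "\<not> picked x r y" "picked r x y"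
    using that le ne pos actx actr pasr bothx unfolding lower_def by (smt (verit))
  show "lower h (thr x r y) (thr r x y) 0 1 (y x) (y r) \<le> \<alpha> y x + \<alpha> y r"
    if "\<not> picked x r y" "\<not> picked r x y"
    using that le ne pos actx actr bothx bothr unfolding lower_def by (smt (verit))
qed

end

subsection \<open>The gain function\<close>

text \<open>The right-hand sides below are Bernstein expansions on the interval in question.\<close>

lemma payoff_poly_bound:
  fixes b :: real
  assumes "0 \<le> b" "b \<le> 11/20"
  shows "6391/10000 \<le> 16/25 - (1/100) * b + (46017/500000) * b ^ 2
    - (8984001/25000000) * b ^ 3
    + (135089523/250000000) * b ^ 4 - (11738059029/62500000000) * b ^ 5"
\<comment> \<open>Over the whole interval one Bernstein coefficient would be negative; on the two
  pieces all of them are positive.\<close>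
proof (cases "b \<le> 1/5")
  case True
  have nonneg: "0 \<le> 56250000 - 625000000 * b + 5752125000 * b ^ 2 - 22460002500 * b ^ 3
      + 33772380750 * b ^ 4 - 11738059029 * b ^ 5"
  proof -
    have "56250000 - 625000000 * b + 5752125000 * b ^ 2 - 22460002500 * b ^ 3
        + 33772380750 * b ^ 4 - 11738059029 * b ^ 5 =
      56250000 * (1 - 5 * b) ^ 5
      + 781250000 * b * (1 - 5 * b) ^ 4
      + 7314625000 * b ^ 2 * (1 - 5 * b) ^ 3
      + 40384372500 * b ^ 3 * (1 - 5 * b) ^ 2
      + 103862980750 * b ^ 4 * (1 - 5 * b)
      + 99795657221 * b ^ 5"
      by algebra
    also have "\<dots> \<ge> 0"
      using assms True by (intro add_nonneg_nonneg mult_nonneg_nonneg zero_le_power) auto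
    finally show ?thesis .
  qed
  then show ?thesis by simp
next
  case False
  have nonneg: "0 \<le> 2954355468750000 - 32826171875000000 * b + 302112390234375000 * b ^ 2
      - 1179641443804687500 * b ^ 3 + 1773788760203906250 * b ^ 4 - 616504869063759375 * b ^ 5"
  proof -
    have "2954355468750000 - 32826171875000000 * b + 302112390234375000 * b ^ 2
        - 1179641443804687500 * b ^ 3 + 1773788760203906250 * b ^ 4
        - 616504869063759375 * b ^ 5 =
      99795657221 * (11 - 20 * b) ^ 5
      + 1853556820905 * (5 * b - 1) * (11 - 20 * b) ^ 4
      + 10274611194910 * (5 * b - 1) ^ 2 * (11 - 20 * b) ^ 3
      + 8045568191510 * (5 * b - 1) ^ 3 * (11 - 20 * b) ^ 2
      + 182477345345805 * (5 * b - 1) ^ 4 * (11 - 20 * b)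
      + 689154055535521 * (5 * b - 1) ^ 5"
      by algebra
    also have "\<dots> \<ge> 0"
      using assms False by (intro add_nonneg_nonneg mult_nonneg_nonneg zero_le_power) auto
    finally show ?thesis .
  qed
  then show ?thesis by simp
qed

lemma slope_poly_bound:
  fixes b :: real
  assumes "0 \<le> b" "b \<le> 11/20"
  shows "\<bar>- (171/5000) * b + (62739/500000) * b ^ 2 - (338499/1250000) * b ^ 3 + (92910477/250000000) * b ^ 4\<bar> \<le> 1/100"
proof -
  have lower: "0 \<le> 36602500000 - 125180550000 * b + 459280849500 * b ^ 2
      - 991192771800 * b ^ 3 + 1360302293757 * b ^ 4"
  proof -
    have "36602500000 - 125180550000 * b + 459280849500 * b ^ 2 - 991192771800 * b ^ 3
        + 1360302293757 * b ^ 4 =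
      2500000 * (11 - 20 * b) ^ 4
      + 105950000 * b * (11 - 20 * b) ^ 3
      + 4152709500 * b ^ 2 * (11 - 20 * b) ^ 2
      + 28859946200 * b ^ 3 * (11 - 20 * b)
      + 724017417757 * b ^ 4"
      by algebra
    also have "\<dots> \<ge> 0"
      using assms by (intro add_nonneg_nonneg mult_nonneg_nonneg zero_le_power) auto
    finally show ?thesis .
  qed
  have upper: "0 \<le> 36602500000 + 125180550000 * b - 459280849500 * b ^ 2
      + 991192771800 * b ^ 3 - 1360302293757 * b ^ 4"
  proof -
    have "36602500000 + 125180550000 * b - 459280849500 * b ^ 2 + 991192771800 * b ^ 3
        - 1360302293757 * b ^ 4 =
      2500000 * (11 - 20 * b) ^ 4
      + 294050000 * b * (11 - 20 * b) ^ 3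
      + 7847290500 * b ^ 2 * (11 - 20 * b) ^ 2
      + 131140053800 * b ^ 3 * (11 - 20 * b)
      + 75982582243 * b ^ 4"
      by algebra
    also have "\<dots> \<ge> 0"
      using assms by (intro add_nonneg_nonneg mult_nonneg_nonneg zero_le_power) auto
    finally show ?thesis .
  qed
  show ?thesis by (rule abs_leI) (use lower upper in simp_all)
qed

text \<open>
  The coefficients come from a numerical solution of the linear program that maximises the smallest
  expected gain over all non-decreasing functions bounded by 1/2. Its optimum is about 0.6397.
\<close>

definition cap :: real where "cap = 11/20"

definition cubic :: "real \<Rightarrow> real" where "cubic y = 9/25 + 9/100 * y + 3/10 * y ^ 3"
text \<open>This and \<open>cubic_int2\<close> are the first and second antiderivatives of
  \<open>cubic\<close> that vanish at 0.\<close>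

definition cubic_int :: "real \<Rightarrow> real" where "cubic_int y = 9/25 * y + 9/200 * y ^ 2 + 3/40 * y ^ 4"
definition cubic_int2 :: "real \<Rightarrow> real" where "cubic_int2 y = 9/50 * y ^ 2 + 3/200 * y ^ 3 + 3/200 * y ^ 5"

text \<open>Clamping at 0 as well makes the assumptions of \<open>rdo_gain\<close> hold on all
  reals.\<close>

definition share :: "real \<Rightarrow> real" where "share y = cubic (max 0 (min y cap))"

definition share_int :: "real \<Rightarrow> real" where
  "share_int y = (if y \<le> cap then cubic_int y else cubic_int cap + (y - cap) * cubic cap)"

definition share_int2 :: "real \<Rightarrow> real" where
  "share_int2 y = (if y \<le> cap then cubic_int2 y else cubic_int2 cap + (y - cap) * cubic_int cap + (y - cap) ^ 2 / 2 * cubic cap)"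

section \<open>Monotonicity, antiderivatives and convexity of the gain function\<close>

lemma cubic_mono: "0 \<le> x \<Longrightarrow> x \<le> y \<Longrightarrow> cubic x \<le> cubic y"
  unfolding cubic_def by (intro add_mono mult_left_mono power_mono) auto

lemma share_mono: "x \<le> y \<Longrightarrow> share x \<le> share y"
  unfolding share_def by (rule cubic_mono) auto

lemma share_nonneg: "0 \<le> share x"
  using cubic_mono[of 0 "max 0 (min x cap)"] by (simp add: share_def cubic_def)

lemma share_half: "share x \<le> 1/2"
proof -
  have "share x \<le> cubic cap" unfolding share_def by (rule cubic_mono) (auto simp: cap_def)
  also have "cubic cap \<le> 1/2" by (simp add: cubic_def cap_def power3_eq_cube)
  finally show ?thesis .
qed

lemma share_continuous: "continuous_on S share"
  unfolding share_def cubic_def by (intro continuous_intros)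

lemma share_int_deriv:
  assumes "x \<noteq> cap" "0 < x"
  shows "(share_int has_real_derivative share x) (at x)"
proof (cases "x < cap")
  case True
  have "(cubic_int has_real_derivative share x) (at x)"
    using True assms unfolding cubic_int_def by (auto intro!: derivative_eq_intros simp: share_def cubic_def)
  then show ?thesis
    by (rule has_field_derivative_transform_within_open[of _ _ _ "{..<cap}"])
      (use True in \<open>auto simp: share_int_def\<close>)
next
  case False
  have "((\<lambda>y. cubic_int cap + (y - cap) * cubic cap) has_real_derivative share x) (at x)"
    using False by (auto intro!: derivative_eq_intros simp: share_def cap_def)
  then show ?thesis
    by (rule has_field_derivative_transform_within_open[of _ _ _ "{cap<..}"])
      (use False assms in \<open>auto simp: share_int_def\<close>)
qed

lemma share_int2_deriv:
  assumes "x \<noteq> cap"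
  shows "(share_int2 has_real_derivative share_int x) (at x)"
proof (cases "x < cap")
  case True
  have "(cubic_int2 has_real_derivative share_int x) (at x)"
    using True unfolding cubic_int2_def by (auto intro!: derivative_eq_intros simp: share_int_def cubic_int_def)
  then show ?thesis
    by (rule has_field_derivative_transform_within_open[of _ _ _ "{..<cap}"])
      (use True in \<open>auto simp: share_int2_def\<close>)
next
  case False
  have "((\<lambda>y. cubic_int2 cap + (y - cap) * cubic_int cap + (y - cap) ^ 2 / 2 * cubic cap) has_real_derivative share_int x) (at x)"
    using False assms by (auto intro!: derivative_eq_intros simp: share_int_def)
  then show ?thesis
    by (rule has_field_derivative_transform_within_open[of _ _ _ "{cap<..}"])
      (use False assms in \<open>auto simp: share_int2_def\<close>)
qed

lemma share_int_continuous: "continuous_on S share_int"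
proof -
  \<comment> \<open>Replacing the case split by \<open>min\<close> and \<open>max\<close> exhibits a
    composition of continuous functions.\<close>
  have eq: "share_int = (\<lambda>y. cubic_int (min y cap) + (max y cap - cap) * cubic cap)"
    by (auto simp: share_int_def fun_eq_iff)
  show ?thesis unfolding eq cubic_int_def by (intro continuous_intros)
qed

lemma share_int2_continuous: "continuous_on S share_int2"
proof -
  have eq: "share_int2 = (\<lambda>y. cubic_int2 (min y cap) + (max y cap - cap) * cubic_int cap
      + (max y cap - cap) ^ 2 / 2 * cubic cap)"
    by (auto simp: share_int2_def fun_eq_iff)
  show ?thesis unfolding eq cubic_int2_def by (intro continuous_intros) auto
qed

lemma share_integral:
  assumes "0 \<le> a" "a \<le> b"
  shows "(share has_integral (share_int b - share_int a)) {a..b}"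
  using assms share_int_deriv
  by (intro fundamental_theorem_of_calculus_interior_strong[of "{cap}"] share_int_continuous)
    (auto simp: has_real_derivative_iff_has_vector_derivative)

lemma share_int_integral:
  assumes "0 \<le> a" "a \<le> b"
  shows "(share_int has_integral (share_int2 b - share_int2 a)) {a..b}"
  using assms share_int2_deriv
  by (intro fundamental_theorem_of_calculus_interior_strong[of "{cap}"] share_int2_continuous)
    (auto simp: has_real_derivative_iff_has_vector_derivative)

text \<open>Convexity of \<open>share_int\<close>, whose derivative \<open>share\<close> is
  non-decreasing.\<close>

lemma share_int_tangent:
  assumes "0 \<le> a" "0 \<le> x"
  shows "share_int x \<ge> share_int a + share a * (x - a)"
proof (cases "a \<le> x")
  case True
  have "((\<lambda>_. share a) has_integral (x - a) *\<^sub>R share a) {a..x}"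
    using has_integral_const_real[of "share a" a x] True by simp
  from has_integral_le[OF this share_integral[OF assms(1) True]]
  show ?thesis by (simp add: share_mono mult.commute)
next
  case False
  then have le: "x \<le> a" by simp
  have "((\<lambda>_. share a) has_integral (a - x) *\<^sub>R share a) {x..a}"
    using has_integral_const_real[of "share a" x a] le by simp
  from has_integral_le[OF share_integral[OF assms(2) le] this]
  show ?thesis by (simp add: share_mono algebra_simps)
qed

lemma share_int_lipschitz:
  assumes "0 \<le> a" "a \<le> x"
  shows "share_int x \<le> share_int a + (x - a) / 2"
proof -
  have "((\<lambda>_. 1/2) has_integral (x - a) *\<^sub>R (1/2::real)) {a..x}"
    using has_integral_const_real[of "1/2::real" a x] assms by simp
  from has_integral_le[OF share_integral[OF assms] this]
  have "share_int x - share_int a \<le> (x - a) *\<^sub>R (1/2)" using share_half by blast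
  then show ?thesis by (simp add: field_simps)
qed

text \<open>Integrates over \<open>s\<close> the inequality
  \<open>share_int s >= share_int b - (b - s) / 2\<close>, which comes from the slope bound
  1/2.\<close>

lemma share_int2_lower:
  assumes "0 \<le> a" "a \<le> b"
  shows "share_int2 b - share_int2 a \<ge> (b - a) * share_int b - (b - a) ^ 2 / 4"
proof -
  have "((\<lambda>s. share_int b - (b - s) / 2) has_integral
      (b * share_int b + (b - b) ^ 2 / 4) - (a * share_int b + (b - a) ^ 2 / 4)) {a..b}"
    using assms by (intro fundamental_theorem_of_calculus)
      (auto intro!: derivative_eq_intros simp: has_real_derivative_iff_has_vector_derivative[symmetric] field_simps)
  from has_integral_le[OF this share_int_integral[OF assms]]
  show ?thesis using share_int_lipschitz assms by (fastforce simp: algebra_simps)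
qed

lemma share_int2_upper:
  assumes "0 \<le> a" "0 \<le> x"
  shows "share_int2 x - share_int2 a \<le> (x - a) * share_int a + (x - a) ^ 2 / 4"
proof (cases "a \<le> x")
  case True
  have "((\<lambda>s. share_int a + (s - a) / 2) has_integral
      (x * share_int a + (x - a) ^ 2 / 4) - (a * share_int a + (a - a) ^ 2 / 4)) {a..x}"
    using True by (intro fundamental_theorem_of_calculus)
      (auto intro!: derivative_eq_intros simp: has_real_derivative_iff_has_vector_derivative[symmetric] field_simps)
  from has_integral_le[OF share_int_integral[OF assms(1) True] this]
  show ?thesis using share_int_lipschitz assms by (simp add: algebra_simps)
next
  case False
  then show ?thesis using share_int2_lower[of x a] assms by (simp add: algebra_simps power2_eq_square)
qed

text \<open>The integral of \<open>lower share a b s t\<close> over the unit square. The three lines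
  are the contributions of a first rank below \<open>a\<close>, between \<open>a\<close> and
  \<open>b\<close>, and above \<open>b\<close>.\<close>

definition payoff :: "real \<Rightarrow> real \<Rightarrow> real \<Rightarrow> real \<Rightarrow> real" where
  "payoff a b s t =
     share_int a + a * (share_int b + s * (1 - b)) +
     (share_int2 b - share_int2 a + (b - a) - (b\<^sup>2 - a\<^sup>2) / 2) +
     (1 - b) * (share_int b + t * (1 - b))"

text \<open>The minimum is attained near \<open>a = b = 27/50\<close>, where \<open>share a\<close> is about \<open>1 - a\<close>.\<close>

lemma payoff_unpicked:
  assumes "0 \<le> a" "a \<le> b"
  shows "payoff a b 0 1 \<ge> 0.639"
proof -
  have vals: "share_int (27/50) = 213899292/10^9" "share (27/50) = 4558392/10^7"
    by (simp_all add: share_int_def share_def cap_def cubic_int_def cubic_def power_divide)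
  have tan: "share_int x \<ge> 213899292/10^9 + 4558392/10^7 * (x - 27/50)" if "0 \<le> x" for x
    using share_int_tangent[of "27/50" x] that unfolding vals by simp
  \<comment> \<open>After \<open>share_int2_lower\<close> the coefficients of
    \<open>share_int b\<close>, namely \<open>a\<close>, \<open>b - a\<close> and
    \<open>1 - b\<close>, add up to 1.\<close>
  have "payoff a b 0 1 \<ge> share_int a + share_int b - (b - a)\<^sup>2 / 4 + (1 - a)\<^sup>2 / 2 + (1 - b)\<^sup>2 / 2"
    using share_int2_lower[OF assms] by (simp add: payoff_def field_simps power2_eq_square)
  \<comment> \<open>The left side depends only on \<open>a + b\<close>. The shift is
    \<open>2 * (1 - share (27/50))\<close>, chosen so that the remaining linear term cancels against
    the two tangents.\<close>
  moreover have "(1 - a)\<^sup>2 / 2 + (1 - b)\<^sup>2 / 2 - (b - a)\<^sup>2 / 4 =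
      (a + b - 10883216/10^7)\<^sup>2 / 4 - 4558392/10^7 * (a + b) + 1 - (5441608/10^7)\<^sup>2"
    by (simp add: power2_eq_square field_simps)
  moreover have "0 \<le> (a + b - 10883216/10^7)\<^sup>2" by simp
  moreover have "1 - (5441608/10^7)\<^sup>2 - 2 * 4558392/10^7 * (27/50) + 2 * (213899292/10^9) \<ge> (0.639::real)"
    by (simp add: power2_eq_square)
  ultimately show ?thesis
    using tan[OF assms(1)] tan[of b] assms by argo
qed

text \<open>
  For fixed \<open>b\<close> the payoff is convex in \<open>a\<close>, and its minimum is close to \<open>m = 23/50 * b\<close>. Expanding
  around \<open>m\<close>, where \<open>d\<close> is the slope, leaves two polynomial inequalities in \<open>b\<close>.
\<close>

lemma payoff_picked_low:
  assumes a: "0 \<le> a" and b: "0 \<le> b" "b \<le> cap"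
  shows "payoff a b (1 - share b) (1 - share b) \<ge> 0.639"
proof -
  let ?F = "\<lambda>a. payoff a b (1 - share b) (1 - share b)"
  define m where "m = 23/50 * b"
  define d where "d = share m + (share_int b + (1 - b) * (1 - share b)) - share_int m - 1 + m"
  have m: "0 \<le> m" "m \<le> cap" using b by (auto simp: m_def cap_def)
  have val: "?F m = (16/25) - (1/100) * b + (46017/500000) * b ^ 2 - (8984001/25000000) * b ^ 3 + (135089523/250000000) * b ^ 4 - (11738059029/62500000000) * b ^ 5"
    using b m unfolding payoff_def share_int_def share_int2_def share_def cubic_def cubic_int_def cubic_int2_def
    by (simp, unfold m_def, simp add: divide_simps, algebra)
  have slope: "d = - (171/5000) * b + (62739/500000) * b ^ 2 - (338499/1250000) * b ^ 3 + (92910477/250000000) * b ^ 4"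
    using b m unfolding d_def share_int_def share_int2_def share_def cubic_def cubic_int_def cubic_int2_def
    by (simp, unfold m_def, simp add: divide_simps, algebra)
  \<comment> \<open>The payoff contains \<open>- a^2 / 2\<close> with a minus sign in front, an
    exact quadratic term of coefficient 1/2; bounding \<open>share_int2\<close> uses up 1/4 of
    it.\<close>
  have "?F a \<ge> ?F m + d * (a - m) + (a - m)\<^sup>2 / 4"
    using share_int_tangent[of m a] share_int2_upper[of m a] a m
    by (simp add: payoff_def d_def field_simps power2_eq_square)
  moreover have "?F m \<ge> 6391/10000"
    unfolding val using payoff_poly_bound b by (simp add: cap_def)
  \<comment> \<open>Completing the square costs at most \<open>d^2\<close>, and
    \<open>(1/100)^2\<close> is precisely the difference between 0.6391 and 0.639.\<close>
  moreover have "d\<^sup>2 \<le> (1/100)\<^sup>2"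
    using slope_poly_bound[of b] b unfolding slope[symmetric] cap_def by (subst abs_le_square_iff[symmetric]) simp
  moreover have "(d + (a - m) / 2)\<^sup>2 = d\<^sup>2 + d * (a - m) + (a - m)\<^sup>2 / 4"
    by (simp add: power2_eq_square field_simps)
  moreover have "0 \<le> (d + (a - m) / 2)\<^sup>2" by simp
  ultimately show ?thesis by (simp add: power_divide)
qed

text \<open>Beyond \<open>cap\<close> the gain function is constant. For
  \<open>a <= cap <= b\<close> the payoff is at least its value at \<open>b = cap\<close>; for
  \<open>cap <= a\<close> it is bounded explicitly.\<close>

lemma payoff_picked:
  assumes a: "0 \<le> a" "a \<le> b" and b: "b \<le> 1"
  shows "payoff a b (1 - share b) (1 - share b) \<ge> 0.639"
proof -
  let ?F = "\<lambda>a b. payoff a b (1 - share b) (1 - share b)"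
  have vals: "cubic cap = 4594125/10000000" "cubic_int cap = 21847546875/100000000000"
    by (simp_all add: cap_def cubic_def cubic_int_def power_divide)
  consider "b \<le> cap" | "a \<le> cap" "cap \<le> b" | "cap \<le> a" by linarith
  then show ?thesis
  proof cases
    case 1
    then show ?thesis using payoff_picked_low a by simp
  next
    case 2
    have sb: "share b = cubic cap" "share cap = cubic cap" using 2 by (auto simp: share_def cap_def)
    have ib: "share_int b = cubic_int cap + (b - cap) * cubic cap" "share_int cap = cubic_int cap"
      using 2 by (auto simp: share_int_def)
    have iib: "share_int2 b = cubic_int2 cap + (b - cap) * cubic_int cap + (b - cap) ^ 2 / 2 * cubic cap"
      "share_int2 cap = cubic_int2 cap"
      using 2 by (auto simp: share_int2_def)
    have "?F a b - ?F a cap = (b - cap) * (2 * cubic cap - 1 + cubic cap * (1 - cap)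
        + (1 - 2 * cubic cap) * (cap - a) + (b - cap) * ((1 - cubic cap) / 2 - cubic cap))"
      unfolding payoff_def sb ib iib by (simp add: field_simps power2_eq_square)
    also have "\<dots> \<ge> 0"
    proof (rule mult_nonneg_nonneg)
      show "0 \<le> 2 * cubic cap - 1 + cubic cap * (1 - cap) + (1 - 2 * cubic cap) * (cap - a)
          + (b - cap) * ((1 - cubic cap) / 2 - cubic cap)"
      proof -
        have "0 \<le> (1 - 2 * cubic cap) * (cap - a)" using 2 by (simp add: vals)
        \<comment> \<open>The last factor is negative and \<open>b - cap\<close> is at most
          \<open>1 - cap = 9/20\<close>.\<close>
        moreover have "9/20 * ((1 - cubic cap) / 2 - cubic cap) \<le> (b - cap) * ((1 - cubic cap) / 2 - cubic cap)"
          using b by (intro mult_right_mono_neg) (simp_all add: vals, simp add: cap_def)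
        moreover have "0 \<le> 2 * cubic cap - 1 + cubic cap * (1 - cap) + 9/20 * ((1 - cubic cap) / 2 - cubic cap)"
          by (simp add: vals, simp add: cap_def)
        ultimately show ?thesis by linarith
      qed
    qed (use 2 in simp)
    finally show ?thesis using payoff_picked_low[of a cap] a by (simp add: cap_def)
  next
    case 3
    have sb: "share b = cubic cap" using 3 a by (auto simp: share_def cap_def)
    have ib: "share_int x = cubic_int cap + (x - cap) * cubic cap" if "cap \<le> x" for x
      using that by (auto simp: share_int_def)
    have iib: "share_int2 x = cubic_int2 cap + (x - cap) * cubic_int cap + (x - cap) ^ 2 / 2 * cubic cap"
      if "cap \<le> x" for x
      using that by (auto simp: share_int2_def)
    have "?F a b = 2 * cubic_int cap + cubic cap * (a - cap) + cubic cap * (b - cap)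
        + (1 - b) * (1 - cubic cap) + (b - a)\<^sup>2 / 2 * (1 - cubic cap) + (b - a) * (1 - b) * cubic cap"
      using 3 a unfolding payoff_def sb by (simp add: ib iib field_simps power2_eq_square)
    \<comment> \<open>What is kept is linear and decreasing in \<open>b\<close>; at
      \<open>b = 1\<close> it is about 0.6437.\<close>
    also have "\<dots> \<ge> 2 * cubic_int cap + cubic cap * (b - cap) + (1 - b) * (1 - cubic cap)"
      using 3 a b vals by simp
    finally show ?thesis using b unfolding vals by (simp add: cap_def field_simps)
  qed
qed

subsection \<open>Expected gain of an edge\<close>

abbreviation unit_uniform :: "real measure" where
  "unit_uniform \<equiv> uniform_measure lborel {0..1}"

lemma prob_space_unit_uniform: "prob_space unit_uniform"
  by (rule prob_space_uniform_measure) auto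

lemma AE_unit_uniform:
  assumes "finite F"
  shows "AE p in unit_uniform. p \<in> {0..1} - F"
proof -
  have "AE p in lborel. p \<notin> F"
    using assms by (intro AE_not_in) (auto simp: finite_imp_null_set_lborel)
  then show ?thesis by (auto intro!: AE_uniform_measureI)
qed

lemma nn_integral_unit_uniform:
  assumes f: "f \<in> borel_measurable borel" "\<And>x. x \<in> {0..1} \<Longrightarrow> 0 \<le> f x" "(f has_integral I) {0..1}"
  shows "(\<integral>\<^sup>+x. ennreal (f x) \<partial>unit_uniform) = ennreal I"
proof -
  have "(\<integral>\<^sup>+x. ennreal (f x) \<partial>unit_uniform) = (\<integral>\<^sup>+x. ennreal (f x) * indicator {0..1} x \<partial>lborel)"
    using f(1) by (subst nn_integral_uniform_measure) (auto simp: divide_ennreal_def)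
  also have "\<dots> = ennreal I" by (rule nn_integral_has_integral_lebesgue'[OF f(2,3)])
  finally show ?thesis .
qed

lemma share_measurable [measurable]: "share \<in> borel_measurable borel"
  using share_continuous by (rule borel_measurable_continuous_onI)

lemma share_int_measurable [measurable]: "share_int \<in> borel_measurable borel"
  using share_int_continuous by (rule borel_measurable_continuous_onI)

lemma share_int_0: "share_int 0 = 0"
  by (simp add: share_int_def cap_def cubic_int_def)

lemma has_integral_spike_Icc:
  fixes a b :: real
  assumes "(f has_integral y) {a..b}" "\<And>x. a < x \<Longrightarrow> x < b \<Longrightarrow> g x = f x"
  shows "(g has_integral y) {a..b}"
  using has_integral_spike_interior[of f y a b g] assms by simp

text \<open>For each fixed first rank, \<open>lower share\<close> has this shape as a function of
  the second rank.\<close>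

lemma two_piece_integral:
  assumes "0 \<le> c" "c \<le> 1"
  shows "((\<lambda>q. if q < c then u + share q else v) has_integral (u * c + share_int c + v * (1 - c))) {0..1}"
    (is "(?f has_integral _) _")
proof -
  have "((\<lambda>q. u + share q) has_integral (c * u + (share_int c - share_int 0))) {0..c}"
    using has_integral_add[OF has_integral_const_real[of u 0 c] share_integral[of 0 c]] assms by simp
  then have 1: "(?f has_integral (c * u + (share_int c - share_int 0))) {0..c}"
    by (rule has_integral_spike_Icc) auto
  have "((\<lambda>q. v) has_integral ((1 - c) * v)) {c..1}"
    using has_integral_const_real[of v c 1] assms by simp
  then have 2: "(?f has_integral ((1 - c) * v)) {c..1}"
    by (rule has_integral_spike_Icc) auto
  from has_integral_combine[OF assms 1 2] show ?thesis
    by (simp add: share_int_0 algebra_simps)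
qed

lemma share_int_nonneg: "0 \<le> x \<Longrightarrow> 0 \<le> share_int x"
  using share_int_tangent[of 0 x] mult_nonneg_nonneg[OF share_nonneg[of 0], of x] by (simp add: share_int_0)

lemma lower_integral:
  assumes ab: "0 \<le> a" "a \<le> b" "b \<le> 1" and st: "0 \<le> s" "0 \<le> t"
  shows "(\<integral>\<^sup>+p. \<integral>\<^sup>+q. ennreal (lower share a b s t p q) \<partial>unit_uniform \<partial>unit_uniform)
    = ennreal (payoff a b s t)"
proof -
  define g where "g p = (if p < a then share p + (share_int b + s * (1 - b))
    else if p < b then share_int p + 1 - p else share_int b + t * (1 - b))" for p
  have g_nonneg: "0 \<le> g p" if "p \<in> {0..1}" for p
    using ab st that share_nonneg share_int_nonneg[of b] share_int_nonneg[of p]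
    by (auto simp: g_def intro!: add_nonneg_nonneg)
  have inner: "(\<integral>\<^sup>+q. ennreal (lower share a b s t p q) \<partial>unit_uniform) = ennreal (g p)"
    if p: "p \<in> {0..1}" for p
  proof (rule nn_integral_unit_uniform)
    show "lower share a b s t p \<in> borel_measurable borel"
      unfolding lower_def by measurable
    show "0 \<le> lower share a b s t p q" for q
      using st by (auto simp: lower_def share_nonneg)
    consider "p < a" | "a \<le> p" "p < b" | "b \<le> p" by linarith
    then show "(lower share a b s t p has_integral g p) {0..1}"
    proof cases
      case 1
      have "lower share a b s t p = (\<lambda>q. if q < b then share p + share q else share p + s)"
        using 1 by (auto simp: lower_def)
      then show ?thesis
        using two_piece_integral[of b "share p" "share p + s"] ab 1 by (simp add: g_def algebra_simps)
    next
      case 2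
      have "lower share a b s t p = (\<lambda>q. if q < p then 0 + share q else 1)"
        using 2 by (auto simp: lower_def)
      then show ?thesis
        using two_piece_integral[of p 0 1] ab 2 by (simp add: g_def algebra_simps)
    next
      case 3
      have "lower share a b s t p = (\<lambda>q. if q < b then 0 + share q else t)"
        using 3 ab by (auto simp: lower_def)
      then show ?thesis
        using two_piece_integral[of b 0 t] ab 3 by (simp add: g_def algebra_simps)
    qed
  qed
  have "(g has_integral payoff a b s t) {0..1}"
  proof -
    let ?c = "share_int b + s * (1 - b)" and ?d = "share_int b + t * (1 - b)"
    have "((\<lambda>p. share p + ?c) has_integral (share_int a - share_int 0 + a * ?c)) {0..a}"
      using has_integral_add[OF share_integral[of 0 a] has_integral_const_real[of ?c 0 a]] ab by simp
    then have 1: "(g has_integral (share_int a - share_int 0 + a * ?c)) {0..a}"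
      by (rule has_integral_spike_Icc) (auto simp: g_def)
    have "((\<lambda>p. 1 - p) has_integral ((b - b\<^sup>2 / 2) - (a - a\<^sup>2 / 2))) {a..b}"
      using ab by (intro fundamental_theorem_of_calculus)
        (auto intro!: derivative_eq_intros simp: has_real_derivative_iff_has_vector_derivative[symmetric])
    from has_integral_add[OF share_int_integral[OF ab(1,2)] this]
    have 2: "(g has_integral (share_int2 b - share_int2 a + ((b - b\<^sup>2 / 2) - (a - a\<^sup>2 / 2)))) {a..b}"
      by (rule has_integral_spike_Icc) (auto simp: g_def)
    have "((\<lambda>p. ?d) has_integral ((1 - b) * ?d)) {b..1}"
      using has_integral_const_real[of ?d b 1] ab by simp
    then have 3: "(g has_integral ((1 - b) * ?d)) {b..1}"
      by (rule has_integral_spike_Icc)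
        (use ab in \<open>auto simp: g_def\<close>)
    have "(g has_integral (share_int a - share_int 0 + a * ?c
        + (share_int2 b - share_int2 a + ((b - b\<^sup>2 / 2) - (a - a\<^sup>2 / 2))) + (1 - b) * ?d)) {0..1}"
      using ab by (intro has_integral_combine[OF _ _ has_integral_combine[OF _ _ 1 2] 3]) auto
    moreover have "share_int a - share_int 0 + a * ?c
        + (share_int2 b - share_int2 a + ((b - b\<^sup>2 / 2) - (a - a\<^sup>2 / 2))) + (1 - b) * ?d = payoff a b s t"
      by (simp add: payoff_def share_int_0 field_simps)
    ultimately show ?thesis by simp
  qed
  moreover have "g \<in> borel_measurable borel" unfolding g_def by measurable
  ultimately have "(\<integral>\<^sup>+p. ennreal (g p) \<partial>unit_uniform) = ennreal (payoff a b s t)"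
    using g_nonneg by (intro nn_integral_unit_uniform)
  moreover have "AE p in unit_uniform. (\<integral>\<^sup>+q. ennreal (lower share a b s t p q) \<partial>unit_uniform) = ennreal (g p)"
    using AE_unit_uniform[OF finite.emptyI] by eventually_elim (simp add: inner)
  ultimately show ?thesis by (simp cong: nn_integral_cong_AE)
qed

section \<open>Measurability of the decision order and of the gains\<close>

lemma decision_order_cong:
  assumes "finite V" "\<And>a b. a \<in> V \<Longrightarrow> b \<in> V \<Longrightarrow> y a \<le> y b \<longleftrightarrow> y' a \<le> y' b"
  shows "decision_order V y = decision_order V y'"
proof -
  have "set (SOME us. distinct us \<and> set us = V) = V"
    using someI_ex[of "\<lambda>us. distinct us \<and> set us = V"] finite_distinct_list[OF assms(1)] by blast
  then show ?thesis unfolding decision_order_def using assms(2) by (intro sort_key_cong_order) auto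
qed

lemma measurable_rank [measurable]:
  "a \<in> V \<Longrightarrow> (\<lambda>y. y a) \<in> borel_measurable (rank_measure V)"
  unfolding rank_measure_def
  using measurable_component_singleton[of a V "\<lambda>_. unit_uniform"] by (simp add: measurable_def)

text \<open>The order depends on the ranks only through the relation \<open>R y\<close> on the
  finite set \<open>V\<close>. Each preimage is therefore a finite union of sets cut out by finitely
  many comparisons of coordinates.\<close>

lemma decision_order_measurable:
  assumes fin: "finite V"
  shows "decision_order V \<in> measurable (rank_measure V) (count_space {l. set l = V \<and> distinct l})"
proof -
  let ?M = "rank_measure V"
  define R where "R y = {(a, b) \<in> V \<times> V. y a \<le> y b}" for y :: "'a \<Rightarrow> real"
  have cong: "decision_order V y = decision_order V y'" if "R y = R y'" for y y'
    using that fin by (intro decision_order_cong) (auto simp: R_def set_eq_iff)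
  have sets_R: "{y \<in> space ?M. R y = r} \<in> sets ?M" if r: "r \<subseteq> V \<times> V" for r
  proof -
    have "{y \<in> space ?M. R y = r} = {y \<in> space ?M. \<forall>a\<in>V. \<forall>b\<in>V. y a \<le> y b \<longleftrightarrow> (a, b) \<in> r}"
      using r by (auto simp: R_def)
    also have "\<dots> \<in> sets ?M"
    proof (intro sets.sets_Collect_finite_All fin)
      fix a b assume ab: "a \<in> V" "b \<in> V"
      have le: "{y \<in> space ?M. y a \<le> y b} \<in> sets ?M"
        by (rule borel_measurable_le[OF measurable_rank[OF ab(1)] measurable_rank[OF ab(2)]])
      have lt: "{y \<in> space ?M. y b < y a} \<in> sets ?M"
        by (rule borel_measurable_less[OF measurable_rank[OF ab(2)] measurable_rank[OF ab(1)]])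
      show "{y \<in> space ?M. y a \<le> y b \<longleftrightarrow> (a, b) \<in> r} \<in> sets ?M"
      proof (cases "(a, b) \<in> r")
        case True
        with le show ?thesis by (simp only: simp_thms)
      next
        case False
        with lt show ?thesis by (simp only: simp_thms not_le)
      qed
    qed
    finally show ?thesis .
  qed
  have "decision_order V -` {l} \<inter> space ?M \<in> sets ?M" for l
  proof -
    have "decision_order V -` {l} \<inter> space ?M =
      (\<Union>r\<in>{r \<in> Pow (V \<times> V). \<exists>y'. R y' = r \<and> decision_order V y' = l}. {y \<in> space ?M. R y = r})"
      (is "?L = ?R")
    proof (intro equalityI subsetI)
      fix y assume "y \<in> ?L"
      then have "decision_order V y = l" "y \<in> space ?M" by simp_all
      moreover have "R y \<in> Pow (V \<times> V)" by (auto simp: R_def)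
      ultimately show "y \<in> ?R" by (intro UN_I[of "R y"]) blast+
    next
      fix y assume "y \<in> ?R"
      then obtain y' where "R y = R y'" "decision_order V y' = l" "y \<in> space ?M" by blast
      then show "y \<in> ?L" using cong[of y y'] by simp
    qed
    also have "\<dots> \<in> sets ?M" using fin by (intro sets.finite_UN sets_R) simp_all
    finally show ?thesis .
  qed
  moreover have "finite {l. set l = V \<and> distinct l}"
    using finite_subset_distinct[OF fin] by (rule finite_subset[rotated]) auto
  ultimately show ?thesis
    using decision_order_props[OF fin] by (subst measurable_count_space_eq2) auto
qed

context rdo_gain
begin

text \<open>For a fixed order the gain is a finite sum of measurable functions of single ranks, and
  only finitely many orders occur.\<close>

lemma gain_measurable:
  assumes [measurable]: "h \<in> borel_measurable borel"
  shows "(\<lambda>y. \<alpha> y w) \<in> borel_measurable (rank_measure V)"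
proof (rule measurable_compose_countable'[OF _ decision_order_measurable[OF fin]])
  fix l assume "l \<in> {l. set l = V \<and> distinct l}"
  then have "pairs l \<subseteq> V \<times> V" using pairs_props[of l] by auto
  then show "(\<lambda>y. gain h y (pairs l) w) \<in> borel_measurable (rank_measure V)"
    unfolding gain_def case_prod_beta by (intro borel_measurable_sum) (auto intro!: measurable_compose[OF measurable_rank])
next
  show "countable {l. set l = V \<and> distinct l}"
    using finite_subset_distinct[OF fin] by (intro countable_finite) (rule finite_subset[rotated], auto)
qed

end

lemma (in bipartite_rdo) rdo_gain_share: "rdo_gain V E pref A B share"
  by unfold_locales (rule share_nonneg share_half share_mono; assumption?)+


lemma nn_integral_mono_outside_finite:
  assumes "finite F" "\<And>p. p \<in> {0..1} - F \<Longrightarrow> f p \<le> g p"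
  shows "(\<integral>\<^sup>+p. f p \<partial>unit_uniform) \<le> (\<integral>\<^sup>+p. g p \<partial>unit_uniform)"
  by (rule nn_integral_mono_AE) (use AE_unit_uniform[OF assms(1)] assms(2) in \<open>auto elim: AE_mp\<close>)

section \<open>Averaging over the ranks\<close>

context bipartite_rdo
begin

interpretation rdo_gain V E pref A B share by (rule rdo_gain_share)

definition edge_gain :: "'v \<Rightarrow> 'v \<Rightarrow> ('v \<Rightarrow> real) \<Rightarrow> real" where
  "edge_gain x r y = gain share y (pairs (decision_order V y)) x + gain share y (pairs (decision_order V y)) r"

lemma edge_gain_commute: "edge_gain x r = edge_gain r x"
  by (auto simp: edge_gain_def fun_eq_iff)

lemma edge_gain_measurable [measurable]: "edge_gain x r \<in> borel_measurable (rank_measure V)"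
  unfolding edge_gain_def[abs_def] using gain_measurable by measurable

text \<open>The ranks of all other vertices are frozen in \<open>w\<close>. Inserting
  \<open>p\<close> and \<open>q\<close> leaves thresholds and picks unchanged, and avoiding the
  finite set \<open>F\<close> and \<open>p = q\<close> gives a generic rank vector.\<close>

lemma edge_gain_ge_lower:
  assumes e: "{x, r} \<in> E" and w: "w ` (V - {x, r}) \<subseteq> {0..1}"
    and le: "thr x r w \<le> thr r x w"
    and F: "F = w ` (V - {x, r}) \<union> {thr x r w, thr r x w}"
    and p: "p \<in> {0..1} - F" and q: "q \<in> {0..1} - F" and pq: "p \<noteq> q"
  shows "picked x r w \<Longrightarrow>
      lower share (thr x r w) (thr x r w) (1 - share (thr x r w)) (1 - share (thr x r w)) q p
        \<le> edge_gain x r (w(r := q, x := p))"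
    and "\<not> picked x r w \<Longrightarrow> picked r x w \<Longrightarrow>
      lower share (thr x r w) (thr r x w) (1 - share (thr r x w)) (1 - share (thr r x w)) p q
        \<le> edge_gain x r (w(r := q, x := p))"
    and "\<not> picked x r w \<Longrightarrow> \<not> picked r x w \<Longrightarrow>
      lower share (thr x r w) (thr r x w) 0 1 p q \<le> edge_gain x r (w(r := q, x := p))"
proof -
  let ?y = "w(r := q, x := p)"
  have V: "x \<in> V" "r \<in> V" "x \<noteq> r" using edge_in_V[OF e] by auto
  have y: "?y x = p" "?y r = q" using V by auto
  have xr: "thr x r ?y = thr x r w" "picked x r ?y = picked x r w"
    by (rule local_cong; simp)+
  have rx: "thr r x ?y = thr r x w" "picked r x ?y = picked r x w"
    by (rule local_cong; simp)+
  have "generic x r ?y"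
    unfolding generic_def xr rx y using w p q pq V F by auto
  from gain_lower_aux[OF e _ this, unfolded xr rx y, OF le]
  show "picked x r w \<Longrightarrow>
      lower share (thr x r w) (thr x r w) (1 - share (thr x r w)) (1 - share (thr x r w)) q p
        \<le> edge_gain x r ?y"
    and "\<not> picked x r w \<Longrightarrow> picked r x w \<Longrightarrow>
      lower share (thr x r w) (thr r x w) (1 - share (thr r x w)) (1 - share (thr r x w)) p q
        \<le> edge_gain x r ?y"
    and "\<not> picked x r w \<Longrightarrow> \<not> picked r x w \<Longrightarrow>
      lower share (thr x r w) (thr r x w) 0 1 p q \<le> edge_gain x r ?y"
    by (auto simp: edge_gain_def)
qed

text \<open>The disjunction reflects that one of the three cases uses \<open>lower\<close> with
  interchanged ranks, hence the other order of integration; Fubini later identifies the two.\<close>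

lemma local_expectation_aux:
  assumes e: "{x, r} \<in> E" and w: "w ` (V - {x, r}) \<subseteq> {0..1}"
    and le: "thr x r w \<le> thr r x w"
  shows "(\<integral>\<^sup>+p. \<integral>\<^sup>+q. edge_gain x r (w(r := q, x := p)) \<partial>unit_uniform \<partial>unit_uniform) \<ge> ennreal 0.639 \<or>
    (\<integral>\<^sup>+q. \<integral>\<^sup>+p. edge_gain x r (w(r := q, x := p)) \<partial>unit_uniform \<partial>unit_uniform) \<ge> ennreal 0.639"
proof -
  define F where "F = w ` (V - {x, r}) \<union> {thr x r w, thr r x w}"
  have fF: "finite F" "finite (insert z F)" for z using fin by (auto simp: F_def)
  let ?a = "thr x r w" and ?b = "thr r x w"
  have ab: "0 \<le> ?a" "?a \<le> 1" "0 \<le> ?b" "?b \<le> 1" using thr_bounds by auto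
  have s: "0 \<le> 1 - share z" for z using share_half[of z] by simp
  note lb = edge_gain_ge_lower[OF e w le F_def]
  consider "picked x r w" | "\<not> picked x r w" "picked r x w" | "\<not> picked x r w" "\<not> picked r x w"
    by blast
  then show ?thesis
  proof cases
    case 1
    have "ennreal 0.639 \<le> ennreal (payoff ?a ?a (1 - share ?a) (1 - share ?a))"
      using payoff_picked[of ?a ?a] ab by (intro ennreal_leI) auto
    also have "\<dots> = (\<integral>\<^sup>+q. \<integral>\<^sup>+p. lower share ?a ?a (1 - share ?a) (1 - share ?a) q p
        \<partial>unit_uniform \<partial>unit_uniform)"
      using ab s by (intro lower_integral[symmetric]) auto
    also have "\<dots> \<le> (\<integral>\<^sup>+q. \<integral>\<^sup>+p. edge_gain x r (w(r := q, x := p)) \<partial>unit_uniform \<partial>unit_uniform)"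
      by (intro nn_integral_mono_outside_finite[OF fF(1)] nn_integral_mono_outside_finite[OF fF(2)] ennreal_leI lb 1)
        auto
    finally show ?thesis by blast
  next
    case 2
    have "ennreal 0.639 \<le> ennreal (payoff ?a ?b (1 - share ?b) (1 - share ?b))"
      using payoff_picked[of ?a ?b] ab le by (intro ennreal_leI) auto
    also have "\<dots> = (\<integral>\<^sup>+p. \<integral>\<^sup>+q. lower share ?a ?b (1 - share ?b) (1 - share ?b) p q
        \<partial>unit_uniform \<partial>unit_uniform)"
      using ab s le by (intro lower_integral[symmetric]) auto
    also have "\<dots> \<le> (\<integral>\<^sup>+p. \<integral>\<^sup>+q. edge_gain x r (w(r := q, x := p)) \<partial>unit_uniform \<partial>unit_uniform)"
      by (intro nn_integral_mono_outside_finite[OF fF(1)] nn_integral_mono_outside_finite[OF fF(2)] ennreal_leI lb 2)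
        auto
    finally show ?thesis by blast
  next
    case 3
    have "ennreal 0.639 \<le> ennreal (payoff ?a ?b 0 1)"
      using payoff_unpicked[of ?a ?b] ab le by (intro ennreal_leI) auto
    also have "\<dots> = (\<integral>\<^sup>+p. \<integral>\<^sup>+q. lower share ?a ?b 0 1 p q \<partial>unit_uniform \<partial>unit_uniform)"
      using ab le by (intro lower_integral[symmetric]) auto
    also have "\<dots> \<le> (\<integral>\<^sup>+p. \<integral>\<^sup>+q. edge_gain x r (w(r := q, x := p)) \<partial>unit_uniform \<partial>unit_uniform)"
      by (intro nn_integral_mono_outside_finite[OF fF(1)] nn_integral_mono_outside_finite[OF fF(2)] ennreal_leI lb 3)
        auto
    finally show ?thesis by blast
  qed
qed

lemma sigma_finite_unit_uniform: "sigma_finite_measure unit_uniform"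
  using prob_space_unit_uniform by (simp add: prob_space_imp_sigma_finite)

text \<open>Fubini splits the ranks of \<open>x\<close> and \<open>r\<close> off the product
  measure; the bound then holds for almost every choice of the remaining ranks, whose measure has
  total mass 1.\<close>

lemma edge_expectation:
  assumes e: "{x, r} \<in> E"
  shows "ennreal 0.639 \<le> (\<integral>\<^sup>+y. edge_gain x r y \<partial>rank_measure V)"
proof -
  interpret product_sigma_finite "\<lambda>_::'v. unit_uniform"
    by (simp add: product_sigma_finite_def sigma_finite_unit_uniform)
  interpret UU: pair_sigma_finite unit_uniform unit_uniform
    by (intro pair_sigma_finite.intro sigma_finite_unit_uniform)
  define W where "W = V - {x, r}"
  let ?P = "\<lambda>I. PiM I (\<lambda>_::'v. unit_uniform)"
  let ?f = "\<lambda>y. ennreal (edge_gain x r y)"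
  have V: "x \<in> V" "r \<in> V" "x \<noteq> r" "V = insert x (insert r W)" using edge_in_V[OF e] by (auto simp: W_def)
  have fW: "finite W" "x \<notin> insert r W" "r \<notin> W" using fin V(3) by (auto simp: W_def)
  have fm: "?f \<in> borel_measurable (?P (insert x (insert r W)))"
    unfolding V(4)[symmetric] rank_measure_def[symmetric]
    by (rule measurable_compose[OF edge_gain_measurable measurable_ennreal])
  have upd: "(\<lambda>z. (f z)(i := g z)) \<in> measurable N (?P (insert i J))"
    if f: "f \<in> measurable N (?P J)" and g: "g \<in> measurable N unit_uniform" for f g i J and N :: "'n measure"
    by (rule measurable_fun_upd[OF _ f g]) simp
  have f2: "(\<lambda>(z, p). ?f (z(x := p))) \<in> borel_measurable (?P (insert r W) \<Otimes>\<^sub>M unit_uniform)"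
    unfolding case_prod_beta by (rule measurable_compose[OF upd[OF measurable_fst measurable_snd] fm])
  have f1: "(\<lambda>z. \<integral>\<^sup>+p. ?f (z(x := p)) \<partial>unit_uniform) \<in> borel_measurable (?P (insert r W))"
    by (rule sigma_finite_measure.borel_measurable_nn_integral[OF sigma_finite_unit_uniform f2])
  have "(\<integral>\<^sup>+y. ?f y \<partial>rank_measure V) = (\<integral>\<^sup>+y. ?f y \<partial>?P (insert x (insert r W)))"
    unfolding V(4)[symmetric] rank_measure_def ..
  also have "\<dots> = (\<integral>\<^sup>+z. (\<integral>\<^sup>+p. ?f (z(x := p)) \<partial>unit_uniform) \<partial>?P (insert r W))"
    by (rule product_nn_integral_insert[OF _ fW(2) fm]) (simp add: fW(1))
  also have "\<dots> = (\<integral>\<^sup>+w. (\<integral>\<^sup>+q. (\<integral>\<^sup>+p. ?f (w(r := q, x := p)) \<partial>unit_uniform) \<partial>unit_uniform) \<partial>?P W)"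
    by (rule product_nn_integral_insert[OF fW(1,3) f1])
  finally have eq: "(\<integral>\<^sup>+y. ?f y \<partial>rank_measure V) = \<dots>" .
  have bound: "ennreal 0.639 \<le> (\<integral>\<^sup>+q. (\<integral>\<^sup>+p. ?f (w(r := q, x := p)) \<partial>unit_uniform) \<partial>unit_uniform)"
    if w: "w \<in> space (?P W)" "\<forall>z\<in>W. w z \<in> {0..1}" for w
  proof -
    have "(\<lambda>z. w(r := fst z, x := snd z)) \<in> measurable (unit_uniform \<Otimes>\<^sub>M unit_uniform) (?P (insert x (insert r W)))"
      by (intro upd measurable_const measurable_fst measurable_snd w(1))
    then have "(\<lambda>(q, p). ?f (w(r := q, x := p))) \<in> borel_measurable (unit_uniform \<Otimes>\<^sub>M unit_uniform)"
      unfolding case_prod_beta by (rule measurable_compose[OF _ fm])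
    then have swap: "(\<integral>\<^sup>+p. (\<integral>\<^sup>+q. ?f (w(r := q, x := p)) \<partial>unit_uniform) \<partial>unit_uniform) =
      (\<integral>\<^sup>+q. (\<integral>\<^sup>+p. ?f (w(r := q, x := p)) \<partial>unit_uniform) \<partial>unit_uniform)"
      by (rule UU.Fubini')
    have twist: "w(x := p, r := q) = w(r := q, x := p)" for p q using V(3) by (rule fun_upd_twist)
    have W: "w ` (V - {x, r}) \<subseteq> {0..1}" "w ` (V - {r, x}) \<subseteq> {0..1}" using w(2) by (auto simp: W_def)
    show ?thesis
    \<comment> \<open>The edge is symmetric, so the endpoint with the smaller threshold may be put
      first.\<close>
    proof (cases "thr x r w \<le> thr r x w")
      case True
      then show ?thesis using local_expectation_aux[OF e W(1)] swap by metis
    next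
      case False
      then have "thr r x w \<le> thr x r w" by simp
      moreover have "{r, x} \<in> E" using e by (simp only: insert_commute)
      ultimately show ?thesis
        using local_expectation_aux[of r x w] W(2) swap unfolding twist edge_gain_commute[of r x] by metis
    qed
  qed
  interpret PW: prob_space "?P W" by (intro prob_space_PiM prob_space_unit_uniform)
  \<comment> \<open>The product space contains all real ranks, so membership in [0, 1] holds only
    almost everywhere.\<close>
  have "AE w in ?P W. \<forall>z\<in>W. w z \<in> {0..1}"
  proof (rule AE_finite_allI[OF fW(1)])
    fix z assume "z \<in> W"
    moreover have "AE p in unit_uniform. p \<in> {0..1}" using AE_unit_uniform[OF finite.emptyI] by simp
    ultimately show "AE w in ?P W. w z \<in> {0..1}"
      using prob_space_unit_uniform by (intro AE_PiM_component) simp_all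
  qed
  then have "AE w in ?P W. ennreal 0.639 \<le>
      (\<integral>\<^sup>+q. (\<integral>\<^sup>+p. ?f (w(r := q, x := p)) \<partial>unit_uniform) \<partial>unit_uniform)"
    using AE_space by eventually_elim (rule bound)
  then have "(\<integral>\<^sup>+w. ennreal 0.639 \<partial>?P W) \<le>
      (\<integral>\<^sup>+w. (\<integral>\<^sup>+q. (\<integral>\<^sup>+p. ?f (w(r := q, x := p)) \<partial>unit_uniform) \<partial>unit_uniform) \<partial>?P W)"
    by (rule nn_integral_mono_AE)
  moreover have "(\<integral>\<^sup>+w. ennreal 0.639 \<partial>?P W) = ennreal 0.639"
    by (simp add: PW.emeasure_space_1)
  ultimately show ?thesis unfolding eq by (simp only:)
qed

end

section \<open>Summation over a maximum matching\<close>

theorem theorem1: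
  fixes V :: "'v set"
    and E :: "'v set set"
    and pref :: "'v \<Rightarrow> ('v \<times> 'v) set"
    and M_star :: "'v set set"
  assumes "simple_graph V E"
    and "bipartite V E"
    and "preference_orders V pref"
    and "maximum_matching E M_star"
  shows "(\<integral>y. real (card (rdo V E pref y)) \<partial>rank_measure V) \<ge> 0.639 * real (card M_star)"
proof -
  obtain A B where AB: "A \<union> B = V" "A \<inter> B = {}" "\<forall>e\<in>E. \<exists>a b. a \<in> A \<and> b \<in> B \<and> e = {a, b}"
    using assms(2) unfolding bipartite_def by metis
  interpret bipartite_rdo V E pref A B
    using assms(1,3) AB by unfold_locales (auto simp: simple_graph_def)
  interpret rdo_gain V E pref A B share by (rule rdo_gain_share)
  interpret prob_space "rank_measure V"
    unfolding rank_measure_def by (intro prob_space_PiM prob_space_unit_uniform)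
  have M: "M_star \<subseteq> E" "disjoint M_star"
    using assms(4) by (auto simp: maximum_matching_def matching_def)
  have MV: "e \<subseteq> V \<and> finite e" if "e \<in> M_star" for e
    using that M(1) edge_parts[of e] AB(1) by auto
  then have "M_star \<subseteq> Pow V" by auto
  then have finM: "finite M_star" using fin finite_subset by blast
  have meas: "(\<lambda>y. \<alpha> y w) \<in> borel_measurable (rank_measure V)" for w
    by (rule gain_measurable[OF share_measurable])
  have edge: "ennreal 0.639 \<le> (\<integral>\<^sup>+y. (\<Sum>w\<in>e. \<alpha> y w) \<partial>rank_measure V)" if "e \<in> M_star" for e
  proof -
    have "e \<in> E" using M(1) that by auto
    then obtain x r where e: "e = {x, r}" "{x, r} \<in> E" using edge_parts by blast
    then have "(\<Sum>w\<in>e. \<alpha> y w) = edge_gain x r y" for y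
      using edge_in_V[of x r] by (simp add: edge_gain_def)
    then show ?thesis using edge_expectation[OF e(2)] by simp
  qed
  \<comment> \<open>The edges of \<open>M_star\<close> are disjoint, so no gain is counted twice,
    and the gains of all vertices sum to the number of matched edges.\<close>
  have le: "(\<Sum>e\<in>M_star. \<Sum>w\<in>e. \<alpha> y w) \<le> real (card (rdo V E pref y))" for y
  proof -
    have "(\<Sum>e\<in>M_star. \<Sum>w\<in>e. \<alpha> y w) = (\<Sum>w\<in>\<Union>M_star. \<alpha> y w)"
      using M(2) MV by (subst sum.Union_disjoint) (auto simp: disjoint_def)
    also have "\<dots> \<le> (\<Sum>w\<in>V. \<alpha> y w)"
      using MV fin by (intro sum_mono2) (auto simp: gain_nonneg)
    finally show ?thesis by (simp add: sum_alpha)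
  qed
  \<comment> \<open>Boundedness by a constant allows the return from the nonnegative integral to the
    real-valued one.\<close>
  have int: "integrable (rank_measure V) (\<lambda>y. real (card (rdo V E pref y)))"
  proof (rule integrable_const_bound)
    have "card (pairs (ord y)) \<le> card (V \<times> V)" for y
      using fin by (intro card_mono pairs_ord(2)) simp
    then show "AE y in rank_measure V. norm (real (card (rdo V E pref y))) \<le> real (card (V \<times> V))"
      by (intro AE_I2) (simp add: rdo_def card_rdo_eq_pairs(2) ord_set del: card_cartesian_product)
    show "(\<lambda>y. real (card (rdo V E pref y))) \<in> borel_measurable (rank_measure V)"
      unfolding sum_alpha[symmetric] by (intro borel_measurable_sum meas)
  qed
  have "ennreal (0.639 * real (card M_star)) = (\<Sum>e\<in>M_star. ennreal 0.639)"
    by (subst sum_ennreal) (simp_all add: mult.commute)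
  also have "\<dots> \<le> (\<Sum>e\<in>M_star. \<integral>\<^sup>+y. (\<Sum>w\<in>e. \<alpha> y w) \<partial>rank_measure V)"
    by (intro sum_mono edge)
  also have "\<dots> = (\<integral>\<^sup>+y. (\<Sum>e\<in>M_star. ennreal (\<Sum>w\<in>e. \<alpha> y w)) \<partial>rank_measure V)"
    by (intro nn_integral_sum[symmetric] measurable_compose[OF _ measurable_ennreal]
        borel_measurable_sum meas)
  also have "\<dots> \<le> (\<integral>\<^sup>+y. real (card (rdo V E pref y)) \<partial>rank_measure V)"
    using le by (intro nn_integral_mono) (simp add: sum_ennreal sum_nonneg gain_nonneg ennreal_leI)
  also have "\<dots> = ennreal (\<integral>y. real (card (rdo V E pref y)) \<partial>rank_measure V)"
    using int by (intro nn_integral_eq_integral) auto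
  finally show ?thesis by (simp add: ennreal_le_iff integral_nonneg)
qed

end
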